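(* Let $n\ge1$, $\delta>0$, $\beta<n+4$, and let $f\in H^{s_1}(\mathbf{T}^n)$ and $g\in H^{s_2}(\mathbf{T}^n)$ with $s_1,s_2\in\mathbb{R}$. Let $s=\min\{s_1,s_2+\theta\}$ with $\theta=\max\{0,\frac{\beta-n}{2}\}$. For $t\ge0$ let $$U(t)=(\hat f_0+\hat g_0t)+\sum_{0\ne k\in\mathbb{Z}^n}\left[\hat f_k\cos(\sqrt{-m_k}\,t)+\frac{\hat g_k}{\sqrt{-m_k}}\sin(\sqrt{-m_k}\,t)\right]e^{ik\cdot x}.$$ Then: (1) if $\beta<n$, then $U\in C^\infty([0,\infty),H^q(\mathbf{T}^n))$ for any $q\le s$; (2) if $\beta=n$, then $U\in C^\infty([0,\infty),H^q(\mathbf{T}^n))$ for any $q<s$; (3) if $\beta>n$, then $U\in C^{p+1}([0,\infty),H^q(\mathbf{T}^n))$ for any $q\in\mathbb{R}$ and any positive integer $p$ satisfying $$q-s_1+(p+1)\frac{\beta-n}{2}\le0\quad\text{and}\quad q-s_2+p\,\frac{\beta-n}{2}\le0 .$$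
   Context: For $k\in\mathbb{Z}^n$, $m_k=m^{\delta,\beta}(k)$, where for $\nu\in\mathbb{R}^n$ $$m^{\delta,\beta}(\nu)=-\|\nu\|^2\,{}_2F_3\!\left(1,\tfrac{n+2-\beta}{2};2,\tfrac{n+2}{2},\tfrac{n+4-\beta}{2};-\tfrac14\|\nu\|^2\delta^2\right),$$ ${}_2F_3(a_1,a_2;b_1,b_2,b_3;z)=\sum_{j\ge0}\frac{(a_1)_j(a_2)_j}{(b_1)_j(b_2)_j(b_3)_j}\frac{z^j}{j!}$, $(a)_j=a(a+1)\cdots(a+j-1)$. For $\beta<n+4$ one has $m_k<0$ for all $k\neq0$. $\mathbf{T}^n=\prod_{j=1}^n[0,2\pi]$ is the periodic torus; a periodic distribution $g$ is written $g=\sum_{k\in\mathbb{Z}^n}\hat g_ke^{ik\cdot x}$ with Fourier coefficients $\hat g_k$; for $q\in\mathbb{R}$, $H^q(\mathbf{T}^n)$ is the space of periodic distributions with $\|g\|_{H^q(\mathbf{T}^n)}^2=\sum_{k\in\mathbb{Z}^n}(1+\|k\|^2)^q|\hat g_k|^2<\infty$. The derivative of a map $T:[0,\infty)\to H^q(\mathbf{T}^n)$ at $t$ is $T'(t)=\lim_{h\to0}\frac{T(t+h)-T(t)}{h}$, the limit being taken in the norm of $H^q(\mathbf{T}^n)$ (one-sided at $t=0$). $C^p([0,\infty),H^q(\mathbf{T}^n))$ denotes the space of maps $[0,\infty)\to H^q(\mathbf{T}^n)$ that are $p$ times differentiable in this sense, and $C^\infty$ means this for all $p$. *)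

theory Defs
  imports "HOL-Analysis.Analysis"
begin

definition hypergeo_2F3 :: "real \<Rightarrow> real \<Rightarrow> real \<Rightarrow> real \<Rightarrow> real \<Rightarrow> real \<Rightarrow> real" where
  "hypergeo_2F3 a1 a2 b1 b2 b3 z =
     (\<Sum>j. pochhammer a1 j * pochhammer a2 j /
          (pochhammer b1 j * pochhammer b2 j * pochhammer b3 j) * (z ^ j / fact j))"

definition multiplier :: "real \<Rightarrow> real \<Rightarrow> real ^ 'n \<Rightarrow> real" where
  "multiplier \<delta> \<beta> \<nu> =
     (let n = real CARD('n) in
        - ((norm \<nu>)\<^sup>2) * hypergeo_2F3 1 ((n + 2 - \<beta>) / 2) 2 ((n + 2) / 2) ((n + 4 - \<beta>) / 2)
             (- (1 / 4) * (norm \<nu>)\<^sup>2 * \<delta>\<^sup>2))"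

definition real_vec :: "int ^ 'n \<Rightarrow> real ^ 'n" where
  "real_vec k = (\<chi> i. real_of_int (k $ i))"

definition partial_deriv :: "'n::finite \<Rightarrow> (real ^ 'n \<Rightarrow> complex) \<Rightarrow> real ^ 'n \<Rightarrow> complex" where
  "partial_deriv i \<phi> x = vector_derivative (\<lambda>h. \<phi> (x + h *\<^sub>R axis i 1)) (at 0)"

definition partial_derivs :: "'n::finite list \<Rightarrow> (real ^ 'n \<Rightarrow> complex) \<Rightarrow> real ^ 'n \<Rightarrow> complex" where
  "partial_derivs js \<phi> = foldr partial_deriv js \<phi>"

definition smooth :: "(real ^ 'n \<Rightarrow> complex) \<Rightarrow> bool" where
  "smooth \<phi> \<longleftrightarrow>
     (\<forall>js. continuous_on UNIV (partial_derivs js \<phi>) \<and>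
        (\<forall>i x. (\<lambda>h::real. partial_derivs js \<phi> (x + h *\<^sub>R axis i 1)) differentiable (at 0)))"

definition test_functions :: "(real ^ 'n \<Rightarrow> complex) set" where
  "test_functions = {\<phi>. smooth \<phi> \<and> (\<forall>i x. \<phi> (x + (2 * pi) *\<^sub>R axis i 1) = \<phi> x)}"

definition C_norm :: "nat \<Rightarrow> (real ^ 'n \<Rightarrow> complex) \<Rightarrow> real" where
  "C_norm N \<phi> = (SUP (js, x) \<in> {js. length js \<le> N} \<times> UNIV. cmod (partial_derivs js \<phi> x))"

text \<open>
  A periodic distribution is a continuous linear functional on the periodic test functions,
  the latter carrying the Frechet topology given by the norms \<^const>\<open>C_norm\<close>.
  Its value is fixed to be 0 on functions that are not test functions, so that equal
  distributions are equal as functions.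
\<close>

definition periodic_distributions :: "((real ^ 'n \<Rightarrow> complex) \<Rightarrow> complex) set" where
  "periodic_distributions =
     {u. (\<forall>\<phi>\<in>test_functions. \<forall>\<psi>\<in>test_functions. u (\<lambda>x. \<phi> x + \<psi> x) = u \<phi> + u \<psi>) \<and>
         (\<forall>c. \<forall>\<phi>\<in>test_functions. u (\<lambda>x. c * \<phi> x) = c * u \<phi>) \<and>
         (\<exists>C N. \<forall>\<phi>\<in>test_functions. cmod (u \<phi>) \<le> C * C_norm N \<phi>) \<and>
         (\<forall>\<phi>. \<phi> \<notin> test_functions \<longrightarrow> u \<phi> = 0)}"

definition character :: "int ^ 'n \<Rightarrow> real ^ 'n \<Rightarrow> complex" where
  "character k x = cis (real_vec k \<bullet> x)"

definition fourier_coeff :: "((real ^ 'n \<Rightarrow> complex) \<Rightarrow> complex) \<Rightarrow> int ^ 'n \<Rightarrow> complex" where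
  "fourier_coeff u k = u (character (- k)) / of_real ((2 * pi) ^ CARD('n))"

definition torus :: "(real ^ 'n) set" where
  "torus = cbox 0 (\<chi> i. 2 * pi)"

text \<open>
  The distribution \<open>\<Sum>k. c k * character k\<close>. The series is understood in the sense of
  distributions: tested against \<open>\<phi>\<close>, where a function \<open>h\<close> acts as
  \<open>\<phi> \<mapsto> integral torus (\<lambda>x. h x * \<phi> x)\<close>.
\<close>

definition fourier_series :: "(int ^ 'n \<Rightarrow> complex) \<Rightarrow> (real ^ 'n \<Rightarrow> complex) \<Rightarrow> complex" where
  "fourier_series c \<phi> =
     (if \<phi> \<in> test_functions
      then \<Sum>\<^sub>\<infinity>k. c k * integral torus (\<lambda>x. character k x * \<phi> x) else 0)"

definition sobolev :: "real \<Rightarrow> ((real ^ 'n \<Rightarrow> complex) \<Rightarrow> complex) set" where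
  "sobolev q =
     {u \<in> periodic_distributions.
        (\<lambda>k. (1 + (norm (real_vec k))\<^sup>2) powr q * (cmod (fourier_coeff u k))\<^sup>2) summable_on UNIV}"

definition sobolev_norm :: "real \<Rightarrow> ((real ^ 'n \<Rightarrow> complex) \<Rightarrow> complex) \<Rightarrow> real" where
  "sobolev_norm q u =
     sqrt (\<Sum>\<^sub>\<infinity>k. (1 + (norm (real_vec k))\<^sup>2) powr q * (cmod (fourier_coeff u k))\<^sup>2)"

text \<open>
  The derivative at \<open>t\<close> of a map defined on \<open>{0..}\<close>; the increment \<open>h\<close> is restricted to
  \<open>t + h \<ge> 0\<close>, which makes the limit one-sided at \<open>t = 0\<close> only.
\<close>

definition has_sobolev_derivative ::
    "real \<Rightarrow> (real \<Rightarrow> (real ^ 'n \<Rightarrow> complex) \<Rightarrow> complex) \<Rightarrow>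
     ((real ^ 'n \<Rightarrow> complex) \<Rightarrow> complex) \<Rightarrow> real \<Rightarrow> bool" where
  "has_sobolev_derivative q T D t \<longleftrightarrow>
     D \<in> sobolev q \<and>
     ((\<lambda>h. sobolev_norm q (\<lambda>\<phi>. (T (t + h) \<phi> - T t \<phi>) / of_real h - D \<phi>)) \<longlongrightarrow> 0)
       (at 0 within {h. t + h \<ge> 0})"

text \<open>
  \<open>C_sobolev p q\<close>: the maps from \<open>{0..}\<close> to \<open>sobolev q\<close> that are \<open>p\<close> times differentiable.
  Values at negative times are irrelevant.
\<close>

primrec C_sobolev :: "nat \<Rightarrow> real \<Rightarrow> (real \<Rightarrow> (real ^ 'n \<Rightarrow> complex) \<Rightarrow> complex) set" where
  "C_sobolev 0 q = {T. \<forall>t\<ge>0. T t \<in> sobolev q}"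
| "C_sobolev (Suc p) q =
     {T. (\<forall>t\<ge>0. T t \<in> sobolev q) \<and>
         (\<exists>T'\<in>C_sobolev p q. \<forall>t\<ge>0. has_sobolev_derivative q T (T' t) t)}"

definition Cinf_sobolev :: "real \<Rightarrow> (real \<Rightarrow> (real ^ 'n \<Rightarrow> complex) \<Rightarrow> complex) set" where
  "Cinf_sobolev q = (\<Inter>p. C_sobolev p q)"

definition wave_coeff ::
    "real \<Rightarrow> real \<Rightarrow> ((real ^ 'n \<Rightarrow> complex) \<Rightarrow> complex) \<Rightarrow> ((real ^ 'n \<Rightarrow> complex) \<Rightarrow> complex) \<Rightarrow>
     real \<Rightarrow> int ^ 'n \<Rightarrow> complex" where
  "wave_coeff \<delta> \<beta> f g t k =
     (if k = 0 then fourier_coeff f 0 + fourier_coeff g 0 * of_real t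
      else let \<omega> = sqrt (- multiplier \<delta> \<beta> (real_vec k)) in
        fourier_coeff f k * of_real (cos (\<omega> * t)) +
        fourier_coeff g k / of_real \<omega> * of_real (sin (\<omega> * t)))"

definition wave_solution ::
    "real \<Rightarrow> real \<Rightarrow> ((real ^ 'n \<Rightarrow> complex) \<Rightarrow> complex) \<Rightarrow> ((real ^ 'n \<Rightarrow> complex) \<Rightarrow> complex) \<Rightarrow>
     real \<Rightarrow> (real ^ 'n \<Rightarrow> complex) \<Rightarrow> complex" where
  "wave_solution \<delta> \<beta> f g t = fourier_series (wave_coeff \<delta> \<beta> f g t)"

end

theory Submission
  imports Defs
begin

text \<open>
  Write \<open>\<omega>\<^sub>k = sqrt (- m\<^sub>k)\<close>. On the Fourier side the \<open>j\<close>-th time derivative of the solution is bounded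
  by \<open>\<bar>\<omega>\<^sub>k\<bar> ^ j * \<bar>f\<^sub>k\<bar> + \<bar>\<omega>\<^sub>k\<bar> ^ (j - 1) * \<bar>g\<^sub>k\<bar>\<close> for \<open>j \<ge> 1\<close>, so dominated convergence for the
  difference quotients reduces everything to the growth of the multiplier. That growth is
  \<open>\<bar>m\<^sub>k\<bar> = O((1 + \<parallel>k\<parallel>\<^sup>2) powr \<kappa>)\<close> with \<open>\<kappa> = 0\<close> for \<open>\<beta> < n\<close>, any \<open>\<kappa> > 0\<close> for \<open>\<beta> = n\<close> and
  \<open>\<kappa> = (\<beta> - n) / 2\<close> for \<open>\<beta> > n\<close>. It is obtained by integrating a first order differential equation
  that expresses the hypergeometric function through \<open>(1 - G y) / y\<close>, where \<open>G\<close> is the normalised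
  Bessel function \<open>0F1(; n/2; - y)\<close>, and \<open>\<bar>G\<bar> \<le> 1\<close> by an energy argument.
\<close>

section \<open>Growth of the multiplier\<close>

text \<open>\<open>K / e * x powr e\<close> is an antiderivative of the bound: subtracted from
  \<open>h\<close> it gives a decreasing function, added an increasing one. One form serves both
  signs of \<open>e\<close>, growth for positive and boundedness for negative
  \<open>e\<close>.\<close>

lemma abs_le_of_abs_deriv_le_powr:
  fixes h h' :: "real \<Rightarrow> real" and y0 :: real
  assumes der: "\<And>y. y \<ge> y0 \<Longrightarrow> (h has_real_derivative h' y) (at y)"
    and bd: "\<And>y. y \<ge> y0 \<Longrightarrow> \<bar>h' y\<bar> \<le> K * y powr (e - 1)"
    and e: "e \<noteq> 0" and y0: "y0 > 0" and y: "y \<ge> y0"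
  shows "\<bar>h y\<bar> \<le> \<bar>h y0\<bar> + K / e * (y powr e - y0 powr e)"
proof -
  have der2: "((\<lambda>x. K / e * x powr e) has_real_derivative K * x powr (e - 1)) (at x)" if "x \<ge> y0" for x
    using that e y0 by (auto intro!: derivative_eq_intros)
  have "h y - K / e * y powr e \<le> h y0 - K / e * y0 powr e"
  proof (rule DERIV_nonpos_imp_nonincreasing[OF y])
    fix x :: real assume x: "y0 \<le> x" "x \<le> y"
    show "\<exists>d. ((\<lambda>x. h x - K / e * x powr e) has_real_derivative d) (at x) \<and> d \<le> 0"
      by (rule exI[of _ "h' x - K * x powr (e - 1)"]) (use DERIV_diff[OF der der2] bd[of x] x in auto)
  qed
  moreover have "h y0 + K / e * y0 powr e \<le> h y + K / e * y powr e"
  proof (rule DERIV_nonneg_imp_nondecreasing[OF y])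
    fix x :: real assume x: "y0 \<le> x" "x \<le> y"
    show "\<exists>d. ((\<lambda>x. h x + K / e * x powr e) has_real_derivative d) (at x) \<and> 0 \<le> d"
      by (rule exI[of _ "h' x + K * x powr (e - 1)"]) (use DERIV_add[OF der der2] bd[of x] x in auto)
  qed
  ultimately show ?thesis using e by (simp add: algebra_simps) 
qed

lemma summable_exp_dominated:
  fixes c :: "nat \<Rightarrow> real"
  assumes "\<And>j. \<bar>c j\<bar> \<le> K / fact j"
  shows "summable (\<lambda>j. c j * y ^ j)"
proof (rule summable_comparison_test')
  show "summable (\<lambda>j. K * (\<bar>y\<bar> ^ j / fact j))"
    using summable_exp[of "\<bar>y\<bar>"] by (intro summable_mult) (simp add: field_simps)
  show "norm (c j * y ^ j) \<le> K * (\<bar>y\<bar> ^ j / fact j)" for j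
    using mult_right_mono[OF assms[of j], of "\<bar>y\<bar> ^ j"] by (simp add: abs_mult power_abs)
qed

text \<open>The first factor is at least 1/2 and each later factor \<open>\<nu> + j\<close> is at
  least 1.\<close>

lemma pochhammer_ge_half:
  fixes \<nu> :: real
  assumes "\<nu> \<ge> 1/2"
  shows "pochhammer \<nu> j \<ge> 1/2"
proof (induction j)
  case (Suc j)
  show ?case
  proof (cases "j = 0")
    case False
    hence "\<nu> + real j \<ge> 1" using assms by (cases j) auto
    hence "pochhammer \<nu> j * 1 \<le> pochhammer \<nu> j * (\<nu> + real j)" using Suc by (intro mult_left_mono) auto
    thus ?thesis using Suc unfolding pochhammer_Suc by linarith
  qed (use assms in simp)
qed simp

section \<open>The normalised Bessel function and its energy bound\<close>

definition bessel_coeff :: "real \<Rightarrow> nat \<Rightarrow> real" where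
  "bessel_coeff \<nu> j = (-1) ^ j / (fact j * pochhammer \<nu> j)"

text \<open>
  This is \<open>0F1(; \<nu>; - y)\<close>. It solves \<open>y G'' + \<nu> G' + G = 0\<close>, so the energy
  \<open>G\<^sup>2 + y G'\<^sup>2\<close> has derivative \<open>(1 - 2 \<nu>) G'\<^sup>2\<close> and decreases when \<open>\<nu> \<ge> 1/2\<close>,
  that is, in every dimension \<open>n = 2 \<nu> \<ge> 1\<close>.
\<close>

definition bessel_series :: "real \<Rightarrow> real \<Rightarrow> real" where
  "bessel_series \<nu> y = (\<Sum>j. bessel_coeff \<nu> j * y ^ j)"

lemma abs_bessel_coeff_le: "\<nu> \<ge> 1/2 \<Longrightarrow> \<bar>bessel_coeff \<nu> j\<bar> \<le> 2 / fact j"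
  using pochhammer_ge_half[of \<nu> j] 
  by (auto simp: bessel_coeff_def abs_mult power_abs field_simps)

lemma abs_bessel_series_le_one:
  assumes \<nu>: "\<nu> \<ge> 1/2" and y: "y \<ge> 0"
  shows "\<bar>bessel_series \<nu> y\<bar> \<le> 1"
proof -
  define c where "c = bessel_coeff \<nu>"
  have pp: "pochhammer \<nu> j > 0" for j using pochhammer_ge_half[OF \<nu>, of j] by linarith
  have s0: "summable (\<lambda>j. c j * y ^ j)" for y
    unfolding c_def by (rule summable_exp_dominated[OF abs_bessel_coeff_le[OF \<nu>]])
  have s1: "summable (\<lambda>j. diffs c j * y ^ j)" for y
    by (rule termdiff_converges_all[OF s0])
  have s2: "summable (\<lambda>j. diffs (diffs c) j * y ^ j)" for y
    by (rule termdiff_converges_all[OF s1])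
  define G where "G = (\<lambda>y. \<Sum>j. c j * y ^ j)"
  define G1 where "G1 = (\<lambda>y. \<Sum>j. diffs c j * y ^ j)"
  define G2 where "G2 = (\<lambda>y. \<Sum>j. diffs (diffs c) j * y ^ j)"
  have d0: "(G has_real_derivative G1 y) (at y)" for y
    unfolding G_def G1_def by (rule termdiffs_strong_converges_everywhere[OF s0])
  have d1: "(G1 has_real_derivative G2 y) (at y)" for y
    unfolding G1_def G2_def by (rule termdiffs_strong_converges_everywhere[OF s1])
  have ode: "y * G2 y + \<nu> * G1 y + G y = 0" for y
  proof -
    have cancel: "P * (A * (- z / (A * w * (p * P)))) = - (z / (w * p))" if "P \<noteq> 0" "A \<noteq> 0" for P A z w p :: real
      using that by (simp add: divide_simps)
    \<comment> \<open>The differential equation read off coefficientwise: \<open>diffs c j\<close>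
      is \<open>(j + 1) * c (j + 1)\<close>, and passing from \<open>c j\<close> to
      \<open>c (j + 1)\<close> divides by \<open>- (j + 1) * (\<nu> + j)\<close>.\<close>
    have rec: "(\<nu> + real j) * diffs c j = - c j" for j
      using cancel[of "\<nu> + real j" "real (Suc j)" "(-1) ^ j" "fact j" "pochhammer \<nu> j"] \<nu>
      by (simp add: diffs_def c_def bessel_coeff_def pochhammer_Suc)
    have t: "(\<lambda>j. real j * diffs c j * y ^ j) sums (y * G2 y)"
    proof -
      have "(\<lambda>j. diffs (diffs c) j * y ^ j) sums G2 y" unfolding G2_def using s2 by (rule summable_sums)
      from sums_mult[OF this, of y] have "(\<lambda>j. real (Suc j) * diffs c (Suc j) * y ^ Suc j) sums (y * G2 y)"
        by (simp add: diffs_def mult_ac)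
      from this[THEN sums_Suc] show ?thesis by simp
    qed
    have "(\<lambda>j. real j * diffs c j * y ^ j + \<nu> * (diffs c j * y ^ j) + c j * y ^ j) sums (y * G2 y + \<nu> * G1 y + G y)"
      unfolding G1_def G_def by (intro sums_add t sums_mult summable_sums s0 s1)
    moreover have "(real j * diffs c j * y ^ j + \<nu> * (diffs c j * y ^ j) + c j * y ^ j) = 0" for j
    proof -
      have "real j * diffs c j * y ^ j + \<nu> * (diffs c j * y ^ j) + c j * y ^ j = ((\<nu> + real j) * diffs c j + c j) * y ^ j"
        by (simp add: algebra_simps)
      thus ?thesis using rec[of j] by simp
    qed
    ultimately have "(\<lambda>j. 0) sums (y * G2 y + \<nu> * G1 y + G y)" by (simp only:)
    thus ?thesis using sums_unique2[OF sums_zero] by metis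
  qed
  define E where "E = (\<lambda>y. (G y)\<^sup>2 + y * (G1 y)\<^sup>2)"
  have dE: "(E has_real_derivative (1 - 2 * \<nu>) * (G1 x)\<^sup>2) (at x)" for x
  proof -
    have "(E has_real_derivative (2 * G x * G1 x + ((G1 x)\<^sup>2 + x * (2 * G1 x * G2 x)))) (at x)"
      unfolding E_def by (auto intro!: derivative_eq_intros d0 d1 simp: power2_eq_square)
    \<comment> \<open>Regrouped so that the left side of the differential equation appears as a
      factor and drops out.\<close>
    moreover have "2 * G x * G1 x + ((G1 x)\<^sup>2 + x * (2 * G1 x * G2 x))
        = (1 - 2 * \<nu>) * (G1 x)\<^sup>2 + 2 * G1 x * (x * G2 x + \<nu> * G1 x + G x)"
      by (simp add: algebra_simps power2_eq_square)
    ultimately show ?thesis using ode[of x] by simp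
  qed
  have "E y \<le> E 0"
  proof (rule DERIV_nonpos_imp_nonincreasing[OF y])
    fix x :: real
    have "(1 - 2 * \<nu>) * (G1 x)\<^sup>2 \<le> 0" using \<nu> by (intro mult_nonpos_nonneg) auto
    with dE[of x] show "\<exists>d. (E has_real_derivative d) (at x) \<and> d \<le> 0" by blast
  qed
  moreover have "G 0 = 1" unfolding G_def using powser_zero[of c] by (simp add: c_def bessel_coeff_def)
  moreover have "0 \<le> y * (G1 y)\<^sup>2" using y by simp
  ultimately have "(G y)\<^sup>2 \<le> 1" by (simp add: E_def)
  hence "\<bar>G y\<bar> \<le> 1" by (simp add: abs_square_le_1)
  thus ?thesis by (simp add: G_def bessel_series_def c_def)
qed

text \<open>Equal to \<open>\<nu> (1 - bessel_series \<nu> y) / y\<close>, hence \<open>O(1 / y)\<close>.\<close>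

definition bessel_quotient :: "real \<Rightarrow> real \<Rightarrow> real" where
  "bessel_quotient \<nu> y = (\<Sum>j. (-1) ^ j / (fact (Suc j) * pochhammer (\<nu> + 1) j) * y ^ j)"

text \<open>Removing the constant term 1 from \<open>bessel_series\<close> and multiplying by
  \<open>- \<nu> / y\<close> shifts the index by one, since
  \<open>pochhammer \<nu> (j + 1) = \<nu> * pochhammer (\<nu> + 1) j\<close>. The factor 2 bounds
  the distance of \<open>bessel_series\<close> from 1.\<close>

lemma abs_bessel_quotient_le:
  assumes \<nu>: "\<nu> \<ge> 1/2" and y: "y > 0"
  shows "\<bar>bessel_quotient \<nu> y\<bar> \<le> 2 * \<nu> / y"
proof -
  have pp: "pochhammer \<nu> j > 0" for j using pochhammer_ge_half[OF \<nu>, of j] by linarith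
  have s0: "summable (\<lambda>j. bessel_coeff \<nu> j * y ^ j)"
    by (rule summable_exp_dominated[OF abs_bessel_coeff_le[OF \<nu>]])
  have "(\<lambda>j. bessel_coeff \<nu> (Suc j) * y ^ Suc j) sums (bessel_series \<nu> y - 1)"
    using s0 unfolding bessel_series_def 
    by (subst sums_Suc_iff) (auto simp: bessel_coeff_def summable_sums)
  from sums_mult[OF this, of "- \<nu> / y"]
  have "(\<lambda>j. (-1) ^ j / (fact (Suc j) * pochhammer (\<nu> + 1) j) * y ^ j) sums (- \<nu> / y * (bessel_series \<nu> y - 1))"
  proof (rule sums_cong[THEN iffD1, rotated])
    fix j
    show "- \<nu> / y * (bessel_coeff \<nu> (Suc j) * y ^ Suc j) = (-1) ^ j / (fact (Suc j) * pochhammer (\<nu> + 1) j) * y ^ j"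
      using y \<nu> pp[of "Suc j"] by (simp add: bessel_coeff_def pochhammer_rec field_simps del: fact_Suc)
  qed
  hence "bessel_quotient \<nu> y = - \<nu> / y * (bessel_series \<nu> y - 1)"
    unfolding bessel_quotient_def by (rule sums_unique[symmetric])
  hence "\<bar>bessel_quotient \<nu> y\<bar> = \<nu> / y * \<bar>bessel_series \<nu> y - 1\<bar>"
    using y \<nu> by (simp add: abs_mult)
  also have "\<dots> \<le> \<nu> / y * 2"
    using abs_bessel_series_le_one[OF \<nu>, of y] y \<nu> by (intro mult_left_mono) auto
  finally show ?thesis by (simp add: mult.commute)
qed

text \<open>
  The function \<open>H y = y powr a * 2F3(\<dots>; - y)\<close> has derivative
  \<open>a * y powr (a - 1) * bessel_quotient \<nu> y = O(y powr (a - 2))\<close>.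
\<close>

lemma hypergeo_2F3_bound:
  fixes a \<nu> e y0 :: real
  assumes \<nu>: "\<nu> \<ge> 1/2" and a: "a > -1" and e: "e \<noteq> 0" "e \<ge> a - 1" and y0: "y0 > 0"
  obtains C where "\<And>y. y \<ge> y0 \<Longrightarrow> \<bar>hypergeo_2F3 1 a 2 (\<nu> + 1) (a + 1) (- y)\<bar> \<le> C * y powr (max 0 e - a)"
proof -
  \<comment> \<open>\<open>q\<close> lists the coefficients of \<open>bessel_quotient\<close>,
    \<open>d\<close> those of the hypergeometric series at \<open>- y\<close>:
    \<open>pochhammer 1 j\<close> cancels \<open>fact j\<close>, and \<open>pochhammer 2 j\<close>
    is \<open>fact (Suc j)\<close>.\<close>
  define q where "q = (\<lambda>j. (-1) ^ j / (fact (Suc j) * pochhammer (\<nu> + 1) j) :: real)"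
  define d where "d = (\<lambda>j. pochhammer a j / pochhammer (a + 1) j * q j)"
  have pa: "pochhammer (a + 1) j > 0" for j using a by (intro pochhammer_pos) auto
  have pn: "pochhammer (\<nu> + 1) j \<ge> 1/2" for j using \<nu> by (intro pochhammer_ge_half) auto
  \<comment> \<open>The quotient telescopes to \<open>a / (a + j)\<close>; the product form remains
    valid for \<open>a = 0\<close> and \<open>j = 0\<close>.\<close>
  have rat: "(a + real j) * (pochhammer a j / pochhammer (a + 1) j) = a" for j
    using pa[of j] pochhammer_rec[of a j] by (simp add: pochhammer_Suc field_simps)
  have qb: "\<bar>q j\<bar> \<le> 2 / fact j" for j
  proof -
    have "fact j * 1 \<le> fact (Suc j) * (2 * pochhammer (\<nu> + 1) j)"
      using pn[of j] by (intro mult_mono fact_mono) auto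
    thus ?thesis using pn[of j] by (simp add: q_def abs_mult field_simps del: fact_Suc)
  qed
  have db: "\<bar>d j\<bar> \<le> (2 * max 1 (\<bar>a\<bar> / (a + 1))) / fact j" for j
  proof -
    have "\<bar>pochhammer a j / pochhammer (a + 1) j\<bar> \<le> max 1 (\<bar>a\<bar> / (a + 1))"
    proof (cases "j = 0")
      case False
      hence j: "a + real j \<ge> a + 1" by simp
      have "pochhammer a j / pochhammer (a + 1) j = a / (a + real j)"
        using rat[of j] j a by (simp add: field_simps)
      also have "\<bar>a / (a + real j)\<bar> \<le> \<bar>a\<bar> / (a + 1)"
        using j a by (auto intro!: divide_left_mono simp: abs_divide)
      finally show ?thesis by linarith
    qed simp
    from mult_mono[OF this qb[of j]] show ?thesis by (simp add: d_def abs_mult mult.commute)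
  qed
  have sd: "summable (\<lambda>j. d j * y ^ j)" for y by (rule summable_exp_dominated[OF db])
  have sd1: "summable (\<lambda>j. diffs d j * y ^ j)" for y by (rule termdiff_converges_all[OF sd])
  define F where "F = (\<lambda>y. \<Sum>j. d j * y ^ j)"
  define F1 where "F1 = (\<lambda>y. \<Sum>j. diffs d j * y ^ j)"
  have dF: "(F has_real_derivative F1 y) (at y)" for y
    unfolding F_def F1_def by (rule termdiffs_strong_converges_everywhere[OF sd])
  have hF: "hypergeo_2F3 1 a 2 (\<nu> + 1) (a + 1) (- y) = F y" for y
  proof -
    have p2: "pochhammer 2 j = (fact (Suc j) :: real)" for j
      using pochhammer_rec[of "1::real" j] by (simp add: pochhammer_fact[symmetric])
    show ?thesis unfolding hypergeo_2F3_def F_def d_def q_def p2 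
      by (intro suminf_cong) (simp add: pochhammer_fact[symmetric] power_minus[of y] field_simps)
  qed
  \<comment> \<open>Termwise, \<open>y * F1 y\<close> multiplies \<open>d j\<close> by
    \<open>j\<close>, and \<open>(a + j) * d j = a * q j\<close>. This first order equation trades
    \<open>F\<close> for \<open>bessel_quotient\<close>.\<close>
  have eq: "a * F y + y * F1 y = a * bessel_quotient \<nu> y" for y
  proof -
    have "(\<lambda>j. diffs d j * y ^ j) sums F1 y" unfolding F1_def using sd1 by (rule summable_sums)
    from sums_mult[OF this, of y] have "(\<lambda>j. real (Suc j) * d (Suc j) * y ^ Suc j) sums (y * F1 y)"
      by (simp add: diffs_def mult_ac)
    from this[THEN sums_Suc] have t: "(\<lambda>j. real j * d j * y ^ j) sums (y * F1 y)" by simp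
    have "(\<lambda>j. a * (d j * y ^ j) + real j * d j * y ^ j) sums (a * F y + y * F1 y)"
      unfolding F_def by (intro sums_add sums_mult t summable_sums sd)
    moreover have "a * (d j * y ^ j) + real j * d j * y ^ j = a * (q j * y ^ j)" for j
    proof -
      have "a * (d j * y ^ j) + real j * d j * y ^ j = ((a + real j) * (pochhammer a j / pochhammer (a + 1) j)) * (q j * y ^ j)"
        unfolding d_def by (simp only: distrib_left distrib_right mult_ac)
      thus ?thesis by (simp only: rat)
    qed
    ultimately have "(\<lambda>j. a * (q j * y ^ j)) sums (a * F y + y * F1 y)" by simp
    moreover have "(\<lambda>j. a * (q j * y ^ j)) sums (a * bessel_quotient \<nu> y)"
      unfolding bessel_quotient_def q_def
      by (intro sums_mult summable_sums summable_exp_dominated[OF qb[unfolded q_def]])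
    ultimately show ?thesis by (rule sums_unique2)
  qed
  define H where "H = (\<lambda>y. y powr a * F y)"
  \<comment> \<open>The rate \<open>a - 2\<close> for the derivative of \<open>H\<close> is relaxed
    to \<open>e - 1\<close>, at the price of the factor \<open>y0 powr (a - 1 - e)\<close>; this is
    how \<open>e = 0\<close> is avoided in the integration.\<close>
  define K where "K = \<bar>a\<bar> * (2 * \<nu>) * y0 powr (a - 1 - e)"
  have K0: "K \<ge> 0" using \<nu> by (simp add: K_def)
  have dH: "(H has_real_derivative y powr (a - 1) * (a * bessel_quotient \<nu> y)) (at y)" if "y \<ge> y0" for y
  proof -
    have "(H has_real_derivative a * y powr (a - 1) * F y + F1 y * y powr a) (at y)"
      unfolding H_def using that y0 by (auto intro!: derivative_eq_intros dF)
    moreover have "y powr a = y powr (a - 1) * y" using that y0 by (simp add: powr_diff)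
    ultimately show ?thesis by (simp add: eq[symmetric] algebra_simps)
  qed
  have bH: "\<bar>y powr (a - 1) * (a * bessel_quotient \<nu> y)\<bar> \<le> K * y powr (e - 1)" if "y \<ge> y0" for y
  proof -
    have "\<bar>y powr (a - 1) * (a * bessel_quotient \<nu> y)\<bar> \<le> y powr (a - 1) * (\<bar>a\<bar> * (2 * \<nu> / y))"
      using mult_left_mono[OF mult_left_mono[OF abs_bessel_quotient_le[OF \<nu>, of y], of "\<bar>a\<bar>"], of "y powr (a - 1)"] that y0
      by (simp add: abs_mult)
    also have "\<dots> = \<bar>a\<bar> * (2 * \<nu>) * y powr (a - 1 - e) * y powr (e - 1)"
    proof -
      have "y powr (a - 1 - e) * y powr (e - 1) = y powr (a - 1) / y"
        using that y0 powr_diff[of y "a - 1" 1] by (simp flip: powr_add)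
      thus ?thesis by (simp add: mult.assoc)
    qed
    also have "\<dots> \<le> K * y powr (e - 1)" unfolding K_def
      using that y0 e \<nu> by (intro mult_right_mono mult_left_mono powr_mono2') auto
    finally show ?thesis .
  qed
  \<comment> \<open>The first summand carries the initial value, the second the integrated growth,
    which for \<open>e < 0\<close> never exceeds \<open>K / |e| * y0 powr e\<close>. Both are
    measured against \<open>y powr max 0 e\<close>.\<close>
  define C where "C = \<bar>H y0\<bar> / y0 powr max 0 e + K / \<bar>e\<bar> * (if e > 0 then 1 else y0 powr e)"
  show ?thesis
  proof (rule that)
    fix y :: real assume y: "y \<ge> y0"
    have "\<bar>H y\<bar> \<le> \<bar>H y0\<bar> + K / e * (y powr e - y0 powr e)"
      by (rule abs_le_of_abs_deriv_le_powr[OF dH bH e(1) y0 y])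
    also have "\<dots> \<le> C * y powr (max 0 e)"
    proof -
      have "\<bar>H y0\<bar> / y0 powr max 0 e * y0 powr max 0 e \<le> \<bar>H y0\<bar> / y0 powr max 0 e * y powr (max 0 e)" 
        using y y0 by (intro mult_left_mono powr_mono2) auto
      moreover have "K / e * (y powr e - y0 powr e) \<le> K / \<bar>e\<bar> * (if e > 0 then 1 else y0 powr e) * y powr (max 0 e)"
      proof (cases "e > 0")
        case True thus ?thesis using K0 by (auto simp: max_def intro!: divide_right_mono mult_left_mono)
      next
        case False
        have "K / e * (y powr e - y0 powr e) = K / \<bar>e\<bar> * (y0 powr e - y powr e)" using False e(1) by (simp add: field_simps)
        also have "\<dots> \<le> K / \<bar>e\<bar> * y0 powr e" using K0 by (intro mult_left_mono) auto
        finally show ?thesis using False y y0 by (simp add: max_def)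
      qed
      ultimately show ?thesis using y0 by (simp add: algebra_simps C_def)
    qed
    finally have "\<bar>F y\<bar> * y powr a \<le> C * y powr (max 0 e)"
      by (simp add: H_def abs_mult mult.commute)
    hence "\<bar>F y\<bar> \<le> C * y powr (max 0 e - a)"
      using y y0 by (simp add: powr_diff field_simps)
    thus "\<bar>hypergeo_2F3 1 a 2 (\<nu> + 1) (a + 1) (- y)\<bar> \<le> C * y powr (max 0 e - a)"
      by (simp add: hF)
  qed
qed

section \<open>From the hypergeometric function to the multiplier\<close>

lemma norm_real_vec_ge_one:
  fixes k :: "int ^ 'n"
  assumes "k \<noteq> 0"
  shows "norm (real_vec k) \<ge> 1"
proof -
  obtain i where "k $ i \<noteq> 0" using assms by (auto simp: vec_eq_iff)
  hence "1 \<le> \<bar>real_vec k $ i\<bar>" by (simp add: real_vec_def)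
  also have "\<dots> \<le> norm (real_vec k)" by (rule component_le_norm_cart)
  finally show ?thesis .
qed

text \<open>The squared norm in front raises the exponent of the hypergeometric bound by 1. For
  \<open>e = a - 1\<close> the total \<open>1 + (max 0 e - a)\<close> is
  \<open>max 0 ((\<beta> - n) / 2)\<close>. Having \<open>C \<ge> 1\<close> later provides a
  frequency majorant that is at least 1.\<close>

lemma multiplier_bound:
  fixes \<delta> \<beta> \<kappa> :: real
  assumes \<delta>: "\<delta> > 0" and \<beta>: "\<beta> < real CARD('n) + 4"
    and \<kappa>: "\<kappa> \<ge> 0" "\<kappa> \<ge> (\<beta> - real CARD('n)) / 2" "\<beta> = real CARD('n) \<Longrightarrow> \<kappa> > 0"
  obtains C where "C \<ge> 1" and "\<And>\<nu>::real ^ 'n. norm \<nu> \<ge> 1 \<Longrightarrow> \<bar>multiplier \<delta> \<beta> \<nu>\<bar> \<le> C * (1 + (norm \<nu>)\<^sup>2) powr \<kappa>"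
proof -
  define n where "n = real CARD('n)"
  define a where "a = (n + 2 - \<beta>) / 2"
  \<comment> \<open>\<open>a - 1 = (n - \<beta>) / 2\<close> vanishes exactly for
    \<open>\<beta> = n\<close>, where integration would produce a logarithm; the positive
    \<open>\<kappa>\<close> is the exponent there.\<close>
  define e where "e = (if \<beta> = n then \<kappa> else a - 1)"
  define y0 where "y0 = \<delta>\<^sup>2 / 4"
  have n: "n \<ge> 1" by (simp add: n_def Suc_le_eq)
  have y0: "y0 > 0" using \<delta> by (simp add: y0_def)
  have e: "e \<noteq> 0" "e \<ge> a - 1" using \<kappa> by (auto simp: e_def a_def n_def)
  have e\<kappa>: "1 + (max 0 e - a) \<le> \<kappa>" using \<kappa> by (auto simp: e_def a_def n_def max_def field_simps)
  have "a > -1" using \<beta> by (simp add: a_def n_def)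
  then obtain C where C: "\<And>y. y \<ge> y0 \<Longrightarrow> \<bar>hypergeo_2F3 1 a 2 (n / 2 + 1) (a + 1) (- y)\<bar> \<le> C * y powr (max 0 e - a)"
    using hypergeo_2F3_bound[of "n / 2" a e y0] n e y0 by auto
  define D where "D = \<bar>C\<bar> * y0 powr (max 0 e - a)"
  show ?thesis
  proof (rule that[of "max 1 D"])
    fix \<nu> :: "real ^ 'n" assume \<nu>: "norm \<nu> \<ge> 1"
    define R where "R = (norm \<nu>)\<^sup>2"
    have R: "R \<ge> 1" using \<nu> by (simp add: R_def)
    hence y: "R * y0 \<ge> y0" using y0 by simp
    have "\<bar>multiplier \<delta> \<beta> \<nu>\<bar> = R * \<bar>hypergeo_2F3 1 a 2 (n / 2 + 1) (a + 1) (- (R * y0))\<bar>"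
      using R by (simp add: multiplier_def Let_def abs_mult a_def n_def R_def y0_def field_simps)
    also have "\<dots> \<le> R * (C * (R * y0) powr (max 0 e - a))"
      using C[OF y] R by (intro mult_left_mono) auto
    also have "\<dots> \<le> R * (\<bar>C\<bar> * (R * y0) powr (max 0 e - a))"
      using R by (intro mult_left_mono mult_right_mono) auto
    also have "\<dots> = D * R powr (1 + (max 0 e - a))"
      using R y0 by (simp add: D_def powr_mult powr_add)
    also have "\<dots> \<le> max 1 D * (1 + R) powr \<kappa>"
    proof (intro mult_mono)
      have "R powr (1 + (max 0 e - a)) \<le> R powr \<kappa>" using R e\<kappa> by (intro powr_mono) auto
      also have "\<dots> \<le> (1 + R) powr \<kappa>" using R \<kappa> by (intro powr_mono2) auto
      finally show "R powr (1 + (max 0 e - a)) \<le> (1 + R) powr \<kappa>" .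
    qed auto
    finally show "\<bar>multiplier \<delta> \<beta> \<nu>\<bar> \<le> max 1 D * (1 + (norm \<nu>)\<^sup>2) powr \<kappa>" by (simp add: R_def)
  qed simp
qed

section \<open>Periodic test functions and their Fourier coefficients\<close>

lemma real_vec_nth [simp]: "real_vec k $ i = real_of_int (k $ i)"
  by (simp add: real_vec_def)

lemma real_vec_add: "real_vec (k + l) = real_vec k + real_vec l"
  by (simp add: vec_eq_iff)

lemma real_vec_zero [simp]: "real_vec 0 = 0"
  by (simp add: vec_eq_iff)

lemma continuous_on_shift:
  assumes "continuous_on UNIV (h :: 'a::real_normed_vector \<Rightarrow> 'b::topological_space)"
  shows "continuous_on S (\<lambda>x. h (x + v))"
  by (rule continuous_on_compose2[OF assms]) (auto intro!: continuous_intros)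

text \<open>Cut the shifted box where the \<open>i\<close>-th coordinate equals
  \<open>2 * pi\<close>: the overhanging slab, moved back by one period, fills the slab of the torus
  that the shift has vacated.\<close>

lemma integral_torus_shift:
  fixes h :: "real ^ 'n \<Rightarrow> complex"
  assumes cont: "continuous_on UNIV h" and per: "\<And>x. h (x + (2 * pi) *\<^sub>R axis i 1) = h x"
    and t: "0 \<le> t" "t \<le> 2 * pi"
  shows "integral torus (\<lambda>x. h (x + t *\<^sub>R axis i 1)) = integral torus h"
proof -
  define e :: "real ^ 'n" where "e = axis i 1"
  define b :: "real ^ 'n" where "b = (\<chi> i. 2 * pi)"
  define v where "v = t *\<^sub>R e"
  define u where "u = (2 * pi) *\<^sub>R e"
  \<comment> \<open>Upper corner of the vacated slab, where the \<open>i\<close>-th coordinate is at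
    most \<open>t\<close>; the overhang is this slab translated by \<open>u\<close>.\<close>
  define b' where "b' = b - (2 * pi - t) *\<^sub>R e"
  have e: "e \<in> Basis" by (auto simp: e_def Basis_vec_def)
  have int: "h integrable_on cbox x y" for x y
    by (intro integrable_continuous continuous_on_subset[OF cont]) auto
  have hu: "h \<circ> (+) u = h"
    by (rule ext) (use per in \<open>simp add: u_def e_def add.commute\<close>)
  have s1: "cbox v (b + v) \<inter> {x. x \<bullet> e \<le> 2 * pi} = cbox 0 b \<inter> {x. x \<bullet> e \<ge> t}"
    using t by (auto simp: mem_box_cart v_def e_def b_def axis_def[of i] inner_axis[unfolded axis_def] split: if_splits)
      (smt (verit))+
  have s2: "cbox v (b + v) \<inter> {x. x \<bullet> e \<ge> 2 * pi} = cbox (0 + u) (b' + u)"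
    using t by (auto simp: mem_box_cart v_def e_def b_def b'_def u_def axis_def[of i] inner_axis[unfolded axis_def] split: if_splits)
      (smt (verit))+
  have s3: "cbox 0 b \<inter> {x. x \<bullet> e \<le> t} = cbox 0 b'"
    using t by (auto simp: mem_box_cart v_def e_def b_def b'_def u_def axis_def[of i] inner_axis[unfolded axis_def] split: if_splits)
      (smt (verit))+
  have "integral torus (\<lambda>x. h (x + v)) = integral (cbox v (b + v)) h"
    using integral_shift_cbox_plus[of 0 b h v] by (simp add: torus_def b_def o_def add.commute)
  also have "\<dots> = integral (cbox 0 b \<inter> {x. x \<bullet> e \<ge> t}) h + integral (cbox (0 + u) (b' + u)) h"
    unfolding s1[symmetric] s2[symmetric] by (rule integral_split[OF int e])
  also have "integral (cbox (0 + u) (b' + u)) h = integral (cbox 0 b \<inter> {x. x \<bullet> e \<le> t}) h"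
    unfolding s3 integral_shift_cbox_plus[symmetric] hu ..
  also have "integral (cbox 0 b \<inter> {x. x \<bullet> e \<ge> t}) h + integral (cbox 0 b \<inter> {x. x \<bullet> e \<le> t}) h = integral (cbox 0 b) h"
    using integral_split[OF int e] by (simp add: add.commute)
  finally show ?thesis by (simp add: torus_def b_def v_def e_def)
qed

section \<open>Iterated partial derivatives and closure of the test functions\<close>

lemma partial_derivs_Nil [simp]: "partial_derivs [] \<phi> = \<phi>"
  by (simp add: partial_derivs_def)

lemma partial_derivs_Cons: "partial_derivs (j # js) \<phi> = partial_deriv j (partial_derivs js \<phi>)"
  by (simp add: partial_derivs_def)

lemma partial_derivs_append: "partial_derivs (is @ js) \<phi> = partial_derivs is (partial_derivs js \<phi>)"
  by (simp add: partial_derivs_def)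

lemma partial_deriv_periodic:
  assumes "\<And>x. \<phi> (x + v) = \<phi> x"
  shows "partial_deriv i \<phi> (x + v) = partial_deriv i \<phi> x"
proof -
  have "\<phi> (x + v + h *\<^sub>R axis i 1) = \<phi> (x + h *\<^sub>R axis i 1)" for h
    using assms[of "x + h *\<^sub>R axis i 1"] by (simp add: ac_simps)
  thus ?thesis by (simp add: partial_deriv_def)
qed

lemma test_functions_partial_deriv:
  assumes "\<phi> \<in> test_functions"
  shows "partial_deriv i \<phi> \<in> test_functions"
proof -
  have "partial_derivs js (partial_deriv i \<phi>) = partial_derivs (js @ [i]) \<phi>" for js
    by (simp add: partial_derivs_append partial_derivs_Cons)
  thus ?thesis using assms partial_deriv_periodic[of \<phi>] unfolding test_functions_def smooth_def by auto
qed

lemma test_functions_partial_derivs: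
  "\<phi> \<in> test_functions \<Longrightarrow> partial_derivs js \<phi> \<in> test_functions"
  by (induction js) (auto simp: partial_derivs_Cons test_functions_partial_deriv)

lemma test_function_continuous: "\<phi> \<in> test_functions \<Longrightarrow> continuous_on UNIV \<phi>"
  unfolding test_functions_def smooth_def by (metis (mono_tags, lifting) mem_Collect_eq partial_derivs_Nil)

lemma test_function_periodic: "\<phi> \<in> test_functions \<Longrightarrow> \<phi> (x + (2 * pi) *\<^sub>R axis i 1) = \<phi> x"
  unfolding test_functions_def by auto

text \<open>Smoothness speaks of line derivatives at parameter 0 only; recentring the line at
  parameter \<open>t\<close> and the chain rule for \<open>s - t\<close> give every
  parameter.\<close>

lemma has_vector_derivative_partial_deriv:
  assumes "smooth \<phi>"
  shows "((\<lambda>s. \<phi> (x + s *\<^sub>R axis i 1)) has_vector_derivative partial_deriv i \<phi> (x + t *\<^sub>R axis i 1)) (at t)"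
proof -
  have "(\<lambda>h. \<phi> (x + t *\<^sub>R axis i 1 + h *\<^sub>R axis i 1)) differentiable at (0::real)"
    using assms unfolding smooth_def by (metis partial_derivs_Nil)
  hence "((\<lambda>h. \<phi> (x + t *\<^sub>R axis i 1 + h *\<^sub>R axis i 1)) has_vector_derivative partial_deriv i \<phi> (x + t *\<^sub>R axis i 1)) (at (t - t))"
    by (simp add: vector_derivative_works partial_deriv_def)
  moreover have "((\<lambda>s. s - t) has_vector_derivative 1) (at t)"
    by (auto intro!: derivative_eq_intros)
  ultimately show ?thesis
    using vector_diff_chain_at[of "\<lambda>s. s - t" 1 t] by (fastforce simp: o_def algebra_simps)
qed

lemma partial_derivI:
  "((\<lambda>h. \<phi> (x + h *\<^sub>R axis i 1)) has_vector_derivative d) (at 0) \<Longrightarrow> partial_deriv i \<phi> x = d"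
  unfolding partial_deriv_def by (rule vector_derivative_at)

lemma smooth_partial_derivs: "smooth \<phi> \<Longrightarrow> smooth (partial_derivs js \<phi>)"
  unfolding smooth_def by (metis partial_derivs_append)

lemma partial_derivs_add:
  assumes "smooth \<phi>" "smooth \<psi>"
  shows "partial_derivs js (\<lambda>x. \<phi> x + \<psi> x) = (\<lambda>x. partial_derivs js \<phi> x + partial_derivs js \<psi> x)"
proof (induction js)
  case (Cons j js)
  show ?case
  proof (rule ext)
    fix x
    show "partial_derivs (j # js) (\<lambda>x. \<phi> x + \<psi> x) x = partial_derivs (j # js) \<phi> x + partial_derivs (j # js) \<psi> x"
      using has_vector_derivative_partial_deriv[OF smooth_partial_derivs[OF assms(1)], of js x j 0]
        has_vector_derivative_partial_deriv[OF smooth_partial_derivs[OF assms(2)], of js x j 0]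
      by (auto simp: partial_derivs_Cons Cons intro!: partial_derivI has_vector_derivative_add)
  qed
qed simp

lemma partial_derivs_mult:
  assumes "smooth \<phi>"
  shows "partial_derivs js (\<lambda>x. c * \<phi> x) = (\<lambda>x. c * partial_derivs js \<phi> x)"
proof (induction js)
  case (Cons j js)
  show ?case
  proof (rule ext)
    fix x
    show "partial_derivs (j # js) (\<lambda>x. c * \<phi> x) x = c * partial_derivs (j # js) \<phi> x"
      using has_vector_derivative_partial_deriv[OF smooth_partial_derivs[OF assms(1)], of js x j 0]
      by (auto simp: partial_derivs_Cons Cons intro!: partial_derivI has_vector_derivative_mult_right)
  qed
qed simp

lemma test_functions_add:
  assumes "\<phi> \<in> test_functions" "\<psi> \<in> test_functions"
  shows "(\<lambda>x. \<phi> x + \<psi> x) \<in> test_functions"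
  using assms by (auto simp: test_functions_def smooth_def[of "\<lambda>x. _ x + _ x"] partial_derivs_add)
    (auto simp: smooth_def intro!: continuous_intros differentiable_add)

lemma test_functions_mult:
  assumes "\<phi> \<in> test_functions"
  shows "(\<lambda>x. c * \<phi> x) \<in> test_functions"
  using assms by (auto simp: test_functions_def smooth_def[of "\<lambda>x. _ * _ x"] partial_derivs_mult)
    (auto simp: smooth_def intro!: continuous_intros differentiable_mult)

text \<open>The constant \<open>c\<close> keeps the form stable under repeated
  differentiation.\<close>

lemma partial_deriv_character:
  "partial_deriv i (\<lambda>x. c * character k x) = (\<lambda>x. (c * (\<i> * of_int (k $ i))) * character k x)"
  and differentiable_character: "(\<lambda>h::real. c * character k (x + h *\<^sub>R axis i 1)) differentiable at 0"
proof -
  have *: "((\<lambda>h. c * character k (x + h *\<^sub>R axis i 1)) has_vector_derivative (c * (\<i> * of_int (k $ i))) * character k x) (at 0)" for x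
  proof -
    have eq: "character k (x + h *\<^sub>R axis i 1) = character k x * cis (real_of_int (k $ i) * h)" for h
      by (simp add: character_def inner_add_right inner_axis cis_mult mult.commute)
    have "((\<lambda>h. cis (real_of_int (k $ i) * h)) has_vector_derivative (real_of_int (k $ i) *\<^sub>R (\<i> * cis 0))) (at 0)"
      unfolding has_vector_derivative_def by (auto intro!: derivative_eq_intros simp: algebra_simps)
    from has_vector_derivative_mult_right[OF this, of "c * character k x"] show ?thesis
      unfolding eq by (simp add: scaleR_conv_of_real mult_ac)
  qed
  show "partial_deriv i (\<lambda>x. c * character k x) = (\<lambda>x. (c * (\<i> * of_int (k $ i))) * character k x)"
    by (rule ext, rule partial_derivI[OF *])
  show "(\<lambda>h::real. c * character k (x + h *\<^sub>R axis i 1)) differentiable at 0"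
    by (rule differentiableI_vector[OF *])
qed

lemma continuous_on_character [continuous_intros]: "continuous_on S (character k)"
  unfolding character_def by (auto intro!: continuous_intros)

lemma character_in_test_functions: "character k \<in> test_functions"
proof -
  have *: "\<exists>c. partial_derivs js (character k) = (\<lambda>x. c * character k x)" for js
  proof (induction js)
    case Nil show ?case by (auto intro!: exI[of _ 1])
  next
    case (Cons j js)
    then show ?case by (auto simp: partial_derivs_Cons partial_deriv_character)
  qed
  have "character k (x + (2 * pi) *\<^sub>R axis i 1) = character k x" for x i
    using cis_multiple_2pi[of "real_of_int (k $ i)"]
    by (simp add: character_def inner_add_right inner_axis cis_mult[symmetric] mult_ac)
  moreover have "smooth (character k)" unfolding smooth_def
  proof (intro allI conjI)
    fix js i and x :: "real ^ 'a"
    obtain c where c: "partial_derivs js (character k) = (\<lambda>x. c * character k x)" using * by blast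
    show "continuous_on UNIV (partial_derivs js (character k))"
      unfolding c by (intro continuous_intros)
    show "(\<lambda>h. partial_derivs js (character k) (x + h *\<^sub>R axis i 1)) differentiable at 0"
      unfolding c by (rule differentiable_character)
  qed
  ultimately show ?thesis by (simp add: test_functions_def)
qed

lemma test_function_lattice_periodic:
  assumes "\<phi> \<in> test_functions"
  shows "\<phi> (x + (\<Sum>i\<in>I. (2 * pi * of_int (m i)) *\<^sub>R axis i 1)) = \<phi> x"
proof -
  have nat: "\<phi> (x + (2 * pi * real j) *\<^sub>R axis i 1) = \<phi> x" for x i j
  proof (induction j)
    case (Suc j)
    have "x + (2 * pi * real (Suc j)) *\<^sub>R axis i 1 = (x + (2 * pi * real j) *\<^sub>R axis i 1) + (2 * pi) *\<^sub>R axis i 1"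
      by (simp add: algebra_simps)
    thus ?case using Suc test_function_periodic[OF assms] by metis
  qed simp
  have int: "\<phi> (x + (2 * pi * of_int j) *\<^sub>R axis i 1) = \<phi> x" for x i and j :: int
  proof (cases "j \<ge> 0")
    case True thus ?thesis using nat[of x "nat j" i] by simp
  next
    case False
    thus ?thesis using nat[of "x + (2 * pi * of_int j) *\<^sub>R axis i 1" "nat (- j)" i]
      by (simp add: add.assoc flip: scaleR_left.add)
  qed
  have "finite I" by simp
  thus ?thesis
  proof (induction I)
    case (insert i I)
    thus ?case using int[of "x + (\<Sum>i\<in>I. (2 * pi * of_int (m i)) *\<^sub>R axis i 1)" "m i" i]
      by (simp add: ac_simps)
  qed simp
qed

text \<open>Continuity bounds \<open>\<phi>\<close> on the compact torus, and lattice periodicity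
  carries the bound everywhere; \<open>m\<close> counts the periods that bring each coordinate of
  \<open>x\<close> into the torus.\<close>

lemma test_function_bounded:
  fixes \<phi> :: "real ^ 'n \<Rightarrow> complex"
  assumes "\<phi> \<in> test_functions"
  obtains B where "\<And>x. cmod (\<phi> x) \<le> B"
proof -
  have "compact (\<phi> ` torus)" unfolding torus_def
    by (intro compact_continuous_image continuous_on_subset[OF test_function_continuous[OF assms]] compact_cbox) auto
  then obtain B where B: "\<And>y. y \<in> torus \<Longrightarrow> cmod (\<phi> y) \<le> B"
    by (meson bounded_iff compact_imp_bounded imageI)
  show ?thesis
  proof (rule that)
    fix x :: "real ^ 'n"
    define m where "m i = - \<lfloor>x $ i / (2 * pi)\<rfloor>" for i
    define y where "y = x + (\<Sum>i\<in>UNIV. (2 * pi * of_int (m i)) *\<^sub>R axis i 1)"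
    have y: "y $ j = x $ j + 2 * pi * of_int (m j)" for j
      by (simp add: y_def sum_component axis_def if_distrib[of "(*) _"] cong: if_cong)
    have "0 \<le> y $ j \<and> y $ j \<le> 2 * pi" for j
    proof -
      have "of_int \<lfloor>x $ j / (2 * pi)\<rfloor> * (2 * pi) \<le> x $ j" "x $ j \<le> (of_int \<lfloor>x $ j / (2 * pi)\<rfloor> + 1) * (2 * pi)"
        using pi_gt_zero by (auto simp flip: le_divide_eq divide_le_eq pos_le_divide_eq pos_divide_le_eq)
      thus ?thesis by (simp add: y m_def algebra_simps)
    qed
    hence "y \<in> torus" by (simp add: torus_def mem_box_cart)
    thus "cmod (\<phi> x) \<le> B"
      using B[of y] test_function_lattice_periodic[OF assms, of x m UNIV] by (simp add: y_def)
  qed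
qed

text \<open>The supremum in \<open>C_norm\<close> dominates its members because the set is bounded
  above: finitely many index lists occur, and each derivative is bounded.\<close>

lemma partial_derivs_le_C_norm:
  fixes \<phi> :: "real ^ 'n \<Rightarrow> complex"
  assumes "\<phi> \<in> test_functions" "length js \<le> N"
  shows "cmod (partial_derivs js \<phi> x) \<le> C_norm N \<phi>"
proof -
  have "\<exists>B. \<forall>x. cmod (partial_derivs js \<phi> x) \<le> B" for js
    using test_function_bounded[OF test_functions_partial_derivs[OF assms(1)]] by metis
  then obtain B where B: "\<And>js x. cmod (partial_derivs js \<phi> x) \<le> B js" by metis
  have fin: "finite {js :: 'n list. length js \<le> N}"
    using finite_lists_length_le[of "UNIV :: 'n set" N] by simp
  have "bdd_above ((\<lambda>(js, x). cmod (partial_derivs js \<phi> x)) ` ({js. length js \<le> N} \<times> UNIV))"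
  proof (rule bdd_aboveI2)
    fix p :: "'n list \<times> (real ^ 'n)" assume "p \<in> {js. length js \<le> N} \<times> UNIV"
    thus "(\<lambda>(js, x). cmod (partial_derivs js \<phi> x)) p \<le> Max (B ` {js. length js \<le> N})"
      using fin B by (cases p) (auto simp: Max_ge_iff intro!: order_trans[OF B Max_ge])
  qed
  from cSUP_upper[OF _ this, of "(js, x)"] show ?thesis using assms(2) by (simp add: C_norm_def)
qed

section \<open>Fourier coefficients of derivatives, orthogonality and decay\<close>

lemma has_vector_derivative_difference_quotient:
  fixes f :: "real \<Rightarrow> 'a::real_normed_vector"
  assumes "(f has_vector_derivative D) (at x)"
  shows "((\<lambda>h. (f (x + h) - f x) /\<^sub>R h) \<longlongrightarrow> D) (at 0)"
proof -
  have "((\<lambda>h. norm (f (x + h) - f x - h *\<^sub>R D) / norm h) \<longlongrightarrow> 0) (at 0)"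
    using assms by (simp add: has_vector_derivative_def has_derivative_at)
  moreover have "\<forall>\<^sub>F h in at 0. norm (f (x + h) - f x - h *\<^sub>R D) / norm h = norm ((f (x + h) - f x) /\<^sub>R h - D)"
  proof (intro eventually_at_filter[THEN iffD2] always_eventually allI impI)
    fix h :: real assume h: "h \<noteq> 0"
    have "(f (x + h) - f x) /\<^sub>R h - D = (f (x + h) - f x - h *\<^sub>R D) /\<^sub>R h" using h by (simp add: algebra_simps)
    thus "norm (f (x + h) - f x - h *\<^sub>R D) / norm h = norm ((f (x + h) - f x) /\<^sub>R h - D)"
      by (simp add: divide_inverse mult.commute)
  qed
  ultimately have "((\<lambda>h. norm ((f (x + h) - f x) /\<^sub>R h - D)) \<longlongrightarrow> 0) (at 0)"
    by (rule Lim_transform_eventually)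
  thus ?thesis by (simp add: tendsto_norm_zero_iff LIM_zero_iff)
qed

lemma character_add: "character (k + l) x = character k x * character l x"
  by (simp add: character_def real_vec_add inner_add_left cis_mult)

lemma character_zero [simp]: "character 0 x = 1"
  by (simp add: character_def)

lemma norm_character [simp]: "cmod (character k x) = 1"
  by (simp add: character_def)

lemma character_shift: "character k (x + h *\<^sub>R axis i 1) = character k x * cis (real_of_int (k $ i) * h)"
  by (simp add: character_def inner_add_right inner_axis cis_mult mult.commute)

lemma content_torus: "measure lborel (torus :: (real ^ 'n) set) = (2 * pi) ^ CARD('n)"
  proof -
  have "(0 :: real ^ 'n) \<in> cbox 0 (\<chi> i. 2 * pi)" by (simp add: mem_box_cart)
  thus ?thesis unfolding torus_def by (subst content_cbox_cart) auto
qed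

text \<open>Shift invariance is used in place of integration by parts.\<close>

lemma integral_character_partial_deriv:
  fixes \<phi> :: "real ^ 'n \<Rightarrow> complex"
  assumes \<phi>: "\<phi> \<in> test_functions"
  shows "integral torus (\<lambda>x. character k x * partial_deriv i \<phi> x)
       = - (\<i> * of_int (k $ i)) * integral torus (\<lambda>x. character k x * \<phi> x)"
proof -
  define e :: "real ^ 'n" where "e = axis i 1"
  \<comment> \<open>A sequence of step sizes for dominated convergence; values in
    \<open>(0, 1]\<close> stay within the range \<open>[0, 2 * pi]\<close> of shift
    invariance.\<close>
  define t where "t m = 1 / real (Suc m)" for m
  define d where "d = integral torus (\<lambda>x. character k x * \<phi> x)"
  define c where "c s = cis (- real_of_int (k $ i) * s)" for s
  have t0: "0 < t m" and t1: "t m \<le> 1" for m by (auto simp: t_def)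
  have tlim: "filterlim t (at 0) sequentially"
    unfolding filterlim_at t_def using LIMSEQ_inverse_real_of_nat by (auto simp: inverse_eq_divide)
  have sm: "smooth \<phi>" using \<phi> by (simp add: test_functions_def)
  note cont = test_function_continuous[OF \<phi>]
  note vd = has_vector_derivative_partial_deriv[OF sm, where i = i, folded e_def]
  have int1: "(\<lambda>x. character k x * \<phi> (x + s *\<^sub>R e)) integrable_on torus" for s
    unfolding torus_def by (intro integrable_continuous continuous_intros continuous_on_shift[OF cont])
  \<comment> \<open>The translation passes from \<open>\<phi>\<close> to the character, where it
    becomes the phase \<open>c s\<close> independent of \<open>x\<close>.\<close>
  have shift: "integral torus (\<lambda>x. character k x * \<phi> (x + s *\<^sub>R e)) = c s * d" if "0 \<le> s" "s \<le> 1" for s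
  proof -
    have "character k x * \<phi> (x + s *\<^sub>R e) = c s * (character k (x + s *\<^sub>R e) * \<phi> (x + s *\<^sub>R e))" for x
      by (simp add: e_def character_shift c_def cis_mult flip: mult.assoc)
    hence "integral torus (\<lambda>x. character k x * \<phi> (x + s *\<^sub>R e))
        = c s * integral torus (\<lambda>x. character k (x + s *\<^sub>R e) * \<phi> (x + s *\<^sub>R e))"
      by (simp only: integral_mult_right)
    also have "integral torus (\<lambda>x. character k (x + s *\<^sub>R e) * \<phi> (x + s *\<^sub>R e)) = d"
      unfolding d_def e_def
      by (rule integral_torus_shift[where h = "\<lambda>x. character k x * \<phi> x"])
        (use that pi_ge_two test_function_periodic[OF \<phi>] test_function_periodic[OF character_in_test_functions[of k]]
          in \<open>auto intro!: continuous_intros cont\<close>)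
    finally show ?thesis .
  qed
  obtain B where B: "\<And>x. cmod (partial_deriv i \<phi> x) \<le> B"
    using test_function_bounded[OF test_functions_partial_deriv[OF \<phi>]] by metis
  define F where "F m x = character k x * ((\<phi> (x + t m *\<^sub>R e) - \<phi> x) /\<^sub>R t m)" for m x
  have intF: "F m integrable_on torus" for m
    unfolding torus_def F_def
    by (intro integrable_continuous continuous_intros continuous_on_shift[OF cont] continuous_on_subset[OF cont]) auto
  have intF_eq: "integral torus (F m) = ((c (t m) - c 0) /\<^sub>R t m) * d" for m
  proof -
    have "F m = (\<lambda>x. inverse (t m) *\<^sub>R (character k x * \<phi> (x + t m *\<^sub>R e) - character k x * \<phi> (x + 0 *\<^sub>R e)))"
      by (rule ext) (simp add: F_def algebra_simps)
    hence "integral torus (F m) = inverse (t m) *\<^sub>R (c (t m) * d - c 0 * d)"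
      using shift[of "t m"] shift[of 0] t0[of m] t1[of m]
      by (simp only: integral_cmul integral_diff[OF int1 int1])
    thus ?thesis by (simp add: algebra_simps)
  qed
  have "(\<lambda>m. ((c (t m) - c 0) /\<^sub>R t m) * d) \<longlonglongrightarrow> - (\<i> * of_int (k $ i)) * d"
  proof (intro tendsto_mult_right)
    have "(c has_vector_derivative - (\<i> * of_int (k $ i))) (at 0)"
      unfolding has_vector_derivative_def c_def
      by (auto intro!: derivative_eq_intros simp: scaleR_conv_of_real mult_ac)
    from filterlim_compose[OF has_vector_derivative_difference_quotient[OF this] tlim]
    show "(\<lambda>m. (c (t m) - c 0) /\<^sub>R t m) \<longlonglongrightarrow> - (\<i> * of_int (k $ i))" by simp
  qed
  moreover have "(\<lambda>m. integral torus (F m)) \<longlonglongrightarrow> integral torus (\<lambda>x. character k x * partial_deriv i \<phi> x)"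
  proof (rule dominated_convergence(2)[OF intF])
    show "(\<lambda>x. B) integrable_on (torus :: (real ^ 'n) set)" unfolding torus_def by (rule integrable_const)
    show "norm (F m x) \<le> B" for m x
    proof -
      \<comment> \<open>The mean value inequality along a coordinate line makes the bound
        \<open>B\<close> of the partial derivative a majorant of the quotients.\<close>
      have "norm (\<phi> (x + t m *\<^sub>R e) - \<phi> (x + 0 *\<^sub>R e)) \<le> B * norm (t m - 0)"
      proof (rule differentiable_bound[of UNIV])
        show "((\<lambda>s. \<phi> (x + s *\<^sub>R e)) has_derivative (\<lambda>h. h *\<^sub>R partial_deriv i \<phi> (x + s *\<^sub>R e))) (at s within UNIV)" for s
          using vd[of x s] by (simp add: has_vector_derivative_def)
        show "onorm (\<lambda>h. h *\<^sub>R partial_deriv i \<phi> (x + s *\<^sub>R e)) \<le> B" for s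
          by (rule onorm_le) (use B in \<open>simp add: mult.commute[of B] mult_left_mono\<close>)
      qed auto
      thus ?thesis using t0[of m] by (simp add: F_def norm_mult pos_divide_le_eq flip: divide_inverse_commute)
    qed
    show "(\<lambda>m. F m x) \<longlonglongrightarrow> character k x * partial_deriv i \<phi> x" for x
      unfolding F_def using filterlim_compose[OF has_vector_derivative_difference_quotient[OF vd[of x 0]] tlim]
      by (intro tendsto_mult_left) simp
  qed
  ultimately show ?thesis unfolding d_def[symmetric] intF_eq by (rule LIMSEQ_unique[rotated])
qed

text \<open>For \<open>k \<noteq> 0\<close> the derivative rule is applied to the constant function
  \<open>character 0\<close>: its derivative vanishes, while the factor \<open>k $ i\<close> does
  not.\<close>

lemma integral_character:
  "integral torus (character (k :: int ^ 'n)) = (if k = 0 then of_real ((2 * pi) ^ CARD('n)) else 0)"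
proof (cases "k = 0")
  case True
  hence "character k = (\<lambda>x. 1)" by auto
  thus ?thesis using True content_torus[where ?'n = 'n]
    by (simp add: torus_def scaleR_conv_of_real)
next
  case False
  then obtain i where i: "k $ i \<noteq> 0" by (auto simp: vec_eq_iff)
  have one: "(\<lambda>x. 1) = character (0 :: int ^ 'n)" by auto
  have "partial_deriv i (character (0 :: int ^ 'n)) = (\<lambda>x. 0)"
    using partial_deriv_character[of i 1 "0 :: int ^ 'n"] by (simp add: one)
  with integral_character_partial_deriv[OF character_in_test_functions[of "0 :: int ^ 'n"], of k i]
  have "(\<i> * of_int (k $ i)) * integral torus (character k) = 0" by simp
  thus ?thesis using i False by simp
qed

lemma integral_character_partial_derivs_replicate:
  assumes "\<phi> \<in> test_functions"
  shows "integral torus (\<lambda>x. character k x * partial_derivs (replicate N i) \<phi> x)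
       = (- (\<i> * of_int (k $ i))) ^ N * integral torus (\<lambda>x. character k x * \<phi> x)"
proof (induction N)
  case (Suc N)
  thus ?case
    using integral_character_partial_deriv[OF test_functions_partial_derivs[OF assms], of k i "replicate N i"]
    by (simp add: partial_derivs_Cons)
qed simp

lemma norm_integral_character_le:
  fixes \<phi> :: "real ^ 'n \<Rightarrow> complex"
  assumes "\<phi> \<in> test_functions" "length js \<le> N"
  shows "cmod (integral torus (\<lambda>x. character k x * partial_derivs js \<phi> x)) \<le> (2 * pi) ^ CARD('n) * C_norm N \<phi>"
proof -
  note cont = test_function_continuous[OF test_functions_partial_derivs[OF assms(1)]]
  have nn: "0 \<le> C_norm N \<phi>" 
    by (rule order_trans[OF norm_ge_zero partial_derivs_le_C_norm[OF assms]])
  have "((\<lambda>x. character k x * partial_derivs js \<phi> x) has_integral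
      integral torus (\<lambda>x. character k x * partial_derivs js \<phi> x)) torus"
    unfolding torus_def
    by (intro integrable_integral integrable_continuous continuous_intros continuous_on_subset[OF cont]) auto
  from has_integral_bound[OF nn this[unfolded torus_def]] partial_derivs_le_C_norm[OF assms]
  show ?thesis using content_torus[where ?'n = 'n] by (simp add: norm_mult torus_def mult.commute)
qed

abbreviation weight :: "int ^ 'n \<Rightarrow> real" where
  "weight k \<equiv> 1 + (norm (real_vec k))\<^sup>2"

lemma weight_ge_one: "weight k \<ge> 1" by simp

lemma weight_eq: "weight (k :: int ^ 'n) = 1 + (\<Sum>i\<in>UNIV. (real_of_int (k $ i))\<^sup>2)"
  by (simp add: norm_vec_def L2_set_def sum_nonneg)

text \<open>Differentiate \<open>2 * N\<close> times in a direction \<open>i\<close> where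
  \<open>k $ i\<close> has largest modulus. For \<open>k \<noteq> 0\<close> that modulus is at least
  1, so its square times \<open>1 + n\<close> dominates the weight. At \<open>k = 0\<close> the
  weight is 1.\<close>

lemma test_function_coefficient_decay:
  fixes \<phi> :: "real ^ 'n \<Rightarrow> complex"
  assumes \<phi>: "\<phi> \<in> test_functions"
  shows "weight k ^ N * cmod (integral torus (\<lambda>x. character k x * \<phi> x))
       \<le> (1 + real CARD('n)) ^ N * (2 * pi) ^ CARD('n) * C_norm (2 * N) \<phi>"
proof (cases "k = 0")
  case True
  have nn: "0 \<le> C_norm (2 * N) \<phi>" 
    by (rule order_trans[OF norm_ge_zero partial_derivs_le_C_norm[OF \<phi>, of "[]"]]) simp
  have "cmod (integral torus (\<lambda>x. character k x * \<phi> x)) \<le> (2 * pi) ^ CARD('n) * C_norm (2 * N) \<phi>"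
    using norm_integral_character_le[OF \<phi>, of "[]" "2 * N" k] by simp
  also have "\<dots> \<le> (1 + real CARD('n)) ^ N * ((2 * pi) ^ CARD('n) * C_norm (2 * N) \<phi>)"
    using mult_right_mono[OF one_le_power[of "1 + real CARD('n)" N], of "(2 * pi) ^ CARD('n) * C_norm (2 * N) \<phi>"] nn by simp
  finally show ?thesis using True by (simp add: mult.assoc)
next
  case False
  define d where "d = integral torus (\<lambda>x. character k x * \<phi> x)"
  define M where "M = Max (range (\<lambda>i. (k $ i)\<^sup>2))"
  have "M \<in> range (\<lambda>i. (k $ i)\<^sup>2)" unfolding M_def by (rule Max_in) auto
  then obtain i where i: "M = (k $ i)\<^sup>2" by auto
  have le: "(k $ j)\<^sup>2 \<le> (k $ i)\<^sup>2" for j unfolding i[symmetric] M_def by (rule Max_ge) auto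
  obtain j where "k $ j \<noteq> 0" using False by (auto simp: vec_eq_iff)
  hence "(k $ j)\<^sup>2 \<ge> 1" using zero_less_power2[of "k $ j"] by linarith
  with le[of j] have i1: "real_of_int ((k $ i)\<^sup>2) \<ge> 1" by linarith
  have "(\<Sum>j\<in>UNIV. real_of_int ((k $ j)\<^sup>2)) \<le> (\<Sum>j\<in>(UNIV :: 'n set). real_of_int ((k $ i)\<^sup>2))"
    by (intro sum_mono of_int_le_iff[THEN iffD2] le)
  hence w: "weight k \<le> (1 + real CARD('n)) * (real_of_int (k $ i))\<^sup>2"
    using i1 by (simp add: weight_eq algebra_simps)
  have "weight k ^ N * cmod d \<le> ((1 + real CARD('n)) * (real_of_int (k $ i))\<^sup>2) ^ N * cmod d"
    using w by (intro mult_right_mono power_mono) auto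
  also have "\<dots> = (1 + real CARD('n)) ^ N * cmod ((- (\<i> * of_int (k $ i))) ^ (2 * N) * d)"
    by (simp add: power_mult_distrib norm_mult norm_power power_even_abs flip: power_mult)
  also have "\<dots> = (1 + real CARD('n)) ^ N * cmod (integral torus (\<lambda>x. character k x * partial_derivs (replicate (2 * N) i) \<phi> x))"
    unfolding d_def integral_character_partial_derivs_replicate[OF \<phi>] ..
  also have "\<dots> \<le> (1 + real CARD('n)) ^ N * ((2 * pi) ^ CARD('n) * C_norm (2 * N) \<phi>)"
    by (intro mult_left_mono norm_integral_character_le[OF \<phi>]) auto
  finally show ?thesis by (simp add: d_def mult.assoc)
qed

section \<open>Fourier series with polynomially bounded coefficients\<close>

lemma summable_on_inverse_one_plus_square_int: "(\<lambda>m::int. 1 / (1 + (real_of_int m)\<^sup>2)) summable_on UNIV"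
proof -
  let ?g = "\<lambda>m::int. 1 / (1 + (real_of_int m)\<^sup>2)"
  have s: "summable (\<lambda>n. 1 / (1 + (real n)\<^sup>2))"
  proof (rule summable_comparison_test'[where N = 1])
    show "summable (\<lambda>n. inverse (real n ^ 2))" by (rule inverse_power_summable) simp
    show "norm (1 / (1 + (real n)\<^sup>2)) \<le> inverse (real n ^ 2)" if "n \<ge> 1" for n
      using that by (auto simp: inverse_eq_divide intro!: divide_left_mono mult_pos_pos add_pos_nonneg)
  qed
  have "?g summable_on range int"
    by (subst summable_on_reindex) (auto simp: o_def intro!: summable_nonneg_imp_summable_on s)
  moreover have "?g summable_on range (\<lambda>n. - int (Suc n))"
    using s summable_Suc_iff[THEN iffD2, OF s]
    by (subst summable_on_reindex) (auto simp: o_def inj_def power2_eq_square algebra_simps intro!: summable_nonneg_imp_summable_on)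
  ultimately have "?g summable_on (range int \<union> range (\<lambda>n. - int (Suc n)))"
    by (rule summable_on_Un_disjoint) auto
  also have "range int \<union> range (\<lambda>n. - int (Suc n)) = UNIV"
    using int_cases by blast
  finally show ?thesis .
qed

text \<open>The weight dominates \<open>1 + (k $ i)\<^sup>2\<close> for each of the \<open>n\<close>
  coordinates, so its \<open>n\<close>-th power dominates their product. Enlarging a finite index
  set to a box factors the sum into one-dimensional sums.\<close>

lemma summable_on_inverse_weight_power:
  "(\<lambda>k :: int ^ 'n. 1 / weight k ^ CARD('n)) summable_on UNIV"
proof (rule nonneg_bdd_above_summable_on)
  let ?g = "\<lambda>m::int. 1 / (1 + (real_of_int m)\<^sup>2)"
  show "bdd_above (sum (\<lambda>k :: int ^ 'n. 1 / weight k ^ CARD('n)) ` {F. F \<subseteq> UNIV \<and> finite F})"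
  proof (rule bdd_aboveI2)
    fix F :: "(int ^ 'n) set" assume "F \<in> {F. F \<subseteq> UNIV \<and> finite F}"
    hence F: "finite F" by simp
    have "(\<Sum>k\<in>F. 1 / weight k ^ CARD('n)) \<le> (\<Sum>k\<in>F. \<Prod>i\<in>UNIV. ?g (k $ i))"
    proof (rule sum_mono)
      fix k :: "int ^ 'n"
      have "(\<Prod>i\<in>(UNIV::'n set). 1 / weight k) \<le> (\<Prod>i\<in>UNIV. ?g (k $ i))"
      proof (rule prod_mono, intro conjI)
        fix i
        have "1 + (real_of_int (k $ i))\<^sup>2 \<le> weight k"
          unfolding weight_eq using member_le_sum[of i UNIV "\<lambda>i. (real_of_int (k $ i))\<^sup>2"] by auto
        thus "1 / weight k \<le> ?g (k $ i)" by (intro divide_left_mono) (auto intro!: mult_pos_pos add_pos_nonneg)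
      qed auto
      thus "1 / weight k ^ CARD('n) \<le> (\<Prod>i\<in>UNIV. ?g (k $ i))" by (simp add: power_divide)
    qed
    also have "\<dots> = (\<Sum>h\<in>vec_nth ` F. \<Prod>i\<in>UNIV. ?g (h i))"
      by (subst sum.reindex) (auto simp: inj_on_def vec_eq_iff)
    also have "\<dots> \<le> (\<Sum>h\<in>PiE UNIV (\<lambda>i. (\<lambda>k. k $ i) ` F). \<Prod>i\<in>UNIV. ?g (h i))"
      using F by (intro sum_mono2 finite_PiE prod_nonneg) auto
    also have "\<dots> = (\<Prod>i\<in>UNIV. \<Sum>m\<in>(\<lambda>k. k $ i) ` F. ?g m)"
      using F by (subst prod_sum_PiE) auto
    also have "\<dots> \<le> (\<Prod>i\<in>(UNIV::'n set). \<Sum>\<^sub>\<infinity>m. ?g m)"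
      using F by (intro prod_mono conjI sum_nonneg finite_sum_le_infsum summable_on_inverse_one_plus_square_int) auto
    finally show "(\<Sum>k\<in>F. 1 / weight k ^ CARD('n)) \<le> (\<Prod>i\<in>(UNIV::'n set). \<Sum>\<^sub>\<infinity>m. ?g m)" .
  qed
qed auto

text \<open>Decay of order \<open>M + n\<close> is used: \<open>M\<close> powers of the weight
  offset the growth of \<open>c\<close>, and the other \<open>n\<close> make the lattice sum
  converge.\<close>

lemma fourier_series_term_bound:
  fixes c :: "int ^ 'n \<Rightarrow> complex"
  assumes c: "\<And>k. cmod (c k) \<le> K * weight k ^ M" and \<phi>: "\<phi> \<in> test_functions"
  shows "cmod (c k * integral torus (\<lambda>x. character k x * \<phi> x))
       \<le> \<bar>K\<bar> * (1 + real CARD('n)) ^ (M + CARD('n)) * (2 * pi) ^ CARD('n) * C_norm (2 * (M + CARD('n))) \<phi> * (1 / weight k ^ CARD('n))"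
proof -
  let ?d = "cmod (integral torus (\<lambda>x. character k x * \<phi> x))"
  let ?D = "(1 + real CARD('n)) ^ (M + CARD('n)) * (2 * pi) ^ CARD('n) * C_norm (2 * (M + CARD('n))) \<phi>"
  have w: "weight k > 0" using weight_ge_one[of k] by linarith
  have "cmod (c k) \<le> \<bar>K\<bar> * weight k ^ M"
    using w by (intro order_trans[OF c] mult_right_mono) auto
  hence "cmod (c k) * ?d \<le> \<bar>K\<bar> * weight k ^ M * ?d" by (rule mult_right_mono) simp
  also have "\<dots> = \<bar>K\<bar> * (weight k ^ (M + CARD('n)) * ?d) / weight k ^ CARD('n)"
    using w by (simp add: power_add)
  also have "\<dots> \<le> \<bar>K\<bar> * ?D / weight k ^ CARD('n)"
    using w by (intro divide_right_mono mult_left_mono test_function_coefficient_decay[OF \<phi>]) auto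
  finally show ?thesis by (simp add: norm_mult mult.assoc)
qed

lemma fourier_series_summable:
  fixes c :: "int ^ 'n \<Rightarrow> complex"
  assumes "\<And>k. cmod (c k) \<le> K * weight k ^ M" and "\<phi> \<in> test_functions"
  shows "(\<lambda>k. norm (c k * integral torus (\<lambda>x. character k x * \<phi> x))) summable_on UNIV"
proof (rule summable_on_comparison_test)
  show "(\<lambda>k :: int ^ 'n. \<bar>K\<bar> * (1 + real CARD('n)) ^ (M + CARD('n)) * (2 * pi) ^ CARD('n) *
      C_norm (2 * (M + CARD('n))) \<phi> * (1 / weight k ^ CARD('n))) summable_on UNIV"
    by (rule summable_on_cmult_right[OF summable_on_inverse_weight_power])
qed (use fourier_series_term_bound[OF assms] in auto)

lemma integrable_character_mult:
  assumes "\<phi> \<in> test_functions"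
  shows "(\<lambda>x. character k x * \<phi> x) integrable_on torus"
  unfolding torus_def
  by (intro integrable_continuous continuous_intros continuous_on_subset[OF test_function_continuous[OF assms]]) simp

lemma fourier_series_in_periodic_distributions:
  fixes c :: "int ^ 'n \<Rightarrow> complex"
  assumes c: "\<And>k. cmod (c k) \<le> K * weight k ^ M"
  shows "fourier_series c \<in> periodic_distributions"
  unfolding periodic_distributions_def mem_Collect_eq
proof (intro conjI ballI allI)
  note summ = abs_summable_summable[OF fourier_series_summable[OF c]]
  show "fourier_series c (\<lambda>x. \<phi> x + \<psi> x) = fourier_series c \<phi> + fourier_series c \<psi>"
    if "\<phi> \<in> test_functions" "\<psi> \<in> test_functions" for \<phi> \<psi>
    using that by (simp add: fourier_series_def test_functions_add distrib_left
        integral_add[OF integrable_character_mult integrable_character_mult] infsum_add[OF summ summ])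
  show "fourier_series c (\<lambda>x. a * \<phi> x) = a * fourier_series c \<phi>" if "\<phi> \<in> test_functions" for a \<phi>
    using that by (simp add: fourier_series_def test_functions_mult mult.left_commute[of _ a] infsum_cmult_right')
  show "\<exists>C N. \<forall>\<phi>\<in>test_functions. cmod (fourier_series c \<phi>) \<le> C * C_norm N \<phi>"
  proof (intro exI ballI)
    fix \<phi> :: "real ^ 'n \<Rightarrow> complex" assume \<phi>: "\<phi> \<in> test_functions"
    have "cmod (fourier_series c \<phi>) \<le> (\<Sum>\<^sub>\<infinity>k. cmod (c k * integral torus (\<lambda>x. character k x * \<phi> x)))"
      using \<phi> by (simp add: fourier_series_def norm_infsum_bound[OF fourier_series_summable[OF c]])
    also have "\<dots> \<le> (\<Sum>\<^sub>\<infinity>k :: int ^ 'n. \<bar>K\<bar> * (1 + real CARD('n)) ^ (M + CARD('n)) * (2 * pi) ^ CARD('n) * C_norm (2 * (M + CARD('n))) \<phi> * (1 / weight k ^ CARD('n)))"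
      by (intro infsum_mono fourier_series_summable[OF c \<phi>] summable_on_cmult_right summable_on_inverse_weight_power
          fourier_series_term_bound[OF c \<phi>])
    also have "\<dots> = (\<bar>K\<bar> * (1 + real CARD('n)) ^ (M + CARD('n)) * (2 * pi) ^ CARD('n) * (\<Sum>\<^sub>\<infinity>k :: int ^ 'n. 1 / weight k ^ CARD('n))) * C_norm (2 * (M + CARD('n))) \<phi>"
      by (simp only: infsum_cmult_right') (simp only: mult_ac)
    finally show "cmod (fourier_series c \<phi>) \<le> \<dots>" .
  qed
qed (simp add: fourier_series_def)

text \<open>Tested against \<open>character (- k)\<close>, the series keeps a single term by
  orthogonality, so convergence is automatic.\<close>

lemma fourier_coeff_fourier_series: "fourier_coeff (fourier_series c) k = c k"
proof -
  have "integral torus (\<lambda>x. character l x * character (- k) x) = (if l = k then of_real ((2 * pi) ^ CARD('a)) else 0)" for l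
    using integral_character[of "l - k"] by (simp add: character_add[of l "- k", symmetric])
  hence "fourier_series c (character (- k)) = (\<Sum>\<^sub>\<infinity>l. c l * (if l = k then of_real ((2 * pi) ^ CARD('a)) else 0))"
    by (simp add: fourier_series_def character_in_test_functions)
  also have "\<dots> = (\<Sum>\<^sub>\<infinity>l\<in>{k}. c l * (if l = k then of_real ((2 * pi) ^ CARD('a)) else 0))"
    by (rule infsum_cong_neutral) auto
  finally show ?thesis by (simp add: fourier_coeff_def)
qed

section \<open>Differentiability in the Sobolev norms\<close>

text \<open>Each term is at most the whole sum \<open>S\<close>; taking \<open>M\<close> as
  \<open>|q|\<close> rounded up makes \<open>(weight k ^ M)\<^sup>2\<close> dominate
  \<open>weight k powr - q\<close>.\<close>

lemma polynomially_bounded_of_weighted_summable: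
  fixes c :: "int ^ 'n \<Rightarrow> complex"
  assumes "(\<lambda>k. weight k powr q * (cmod (c k))\<^sup>2) summable_on UNIV"
  obtains K M where "\<And>k. cmod (c k) \<le> K * weight k ^ M"
proof (rule that)
  define S where "S = (\<Sum>\<^sub>\<infinity>k. weight k powr q * (cmod (c k))\<^sup>2)"
  fix k :: "int ^ 'n"
  define M where "M = nat \<lceil>\<bar>q\<bar>\<rceil>"
  have M: "- q \<le> real (2 * M)" unfolding M_def by linarith
  have S: "S \<ge> 0" unfolding S_def by (rule infsum_nonneg) simp
  have w: "weight k > 0" using weight_ge_one[of k] by linarith
  have cancel: "x powr - q * (x powr q * y) = y" if "x > 0" for x y :: real
    using that by (simp add: powr_minus)
  have "weight k powr q * (cmod (c k))\<^sup>2 \<le> S"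
    using finite_sum_le_infsum[OF assms, of "{k}"] by (simp add: S_def)
  hence "weight k powr - q * (weight k powr q * (cmod (c k))\<^sup>2) \<le> weight k powr - q * S"
    by (rule mult_left_mono) simp
  hence "(cmod (c k))\<^sup>2 \<le> weight k powr - q * S" by (simp only: cancel[OF w])
  also have "\<dots> \<le> weight k powr real (2 * M) * S"
    by (rule mult_right_mono[OF powr_mono[OF M weight_ge_one] S])
  also have "weight k powr real (2 * M) = (weight k ^ M)\<^sup>2"
    by (simp only: powr_realpow[OF w] power_even_eq)
  also have "(weight k ^ M)\<^sup>2 * S = (sqrt S * weight k ^ M)\<^sup>2"
    using S by (simp only: power_mult_distrib real_sqrt_pow2 mult.commute)
  finally show "cmod (c k) \<le> sqrt S * weight k ^ M"
    by (rule power2_le_imp_le) (use S w in simp)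
qed

lemma fourier_series_in_sobolev:
  assumes "(\<lambda>k. weight k powr q * (cmod (c k))\<^sup>2) summable_on UNIV"
  shows "fourier_series c \<in> sobolev q"
proof -
  obtain K M where "\<And>k. cmod (c k) \<le> K * weight k ^ M"
    using polynomially_bounded_of_weighted_summable[OF assms] by metis
  from fourier_series_in_periodic_distributions[OF this] assms show ?thesis
    by (simp add: sobolev_def fourier_coeff_fourier_series)
qed

lemma weighted_summable_mono:
  fixes c :: "int ^ 'n \<Rightarrow> complex" and M :: "int ^ 'n \<Rightarrow> real"
  assumes M: "(\<lambda>k. weight k powr q * (M k)\<^sup>2) summable_on UNIV" and le: "\<And>k. cmod (c k) \<le> a * M k"
  shows "(\<lambda>k. weight k powr q * (cmod (c k))\<^sup>2) summable_on UNIV"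
proof (rule summable_on_comparison_test)
  show "(\<lambda>k. a\<^sup>2 * (weight k powr q * (M k)\<^sup>2)) summable_on UNIV"
    by (rule summable_on_cmult_right[OF M])
  show "weight k powr q * (cmod (c k))\<^sup>2 \<le> a\<^sup>2 * (weight k powr q * (M k)\<^sup>2)" for k
    using mult_left_mono[OF power_mono[OF le[of k] norm_ge_zero, of 2], of "weight k powr q"]
    by (simp add: power_mult_distrib mult.left_commute)
qed auto

text \<open>Dominated convergence over the lattice: the error \<open>R h k\<close> of the difference
  quotient tends to 0 for each \<open>k\<close> and is dominated by a multiple of
  \<open>M k\<close>.\<close>

lemma has_sobolev_derivative_fourier_series:
  fixes c c' :: "real \<Rightarrow> int ^ 'n \<Rightarrow> complex"
  assumes deriv: "\<And>s k. ((\<lambda>s. c s k) has_vector_derivative c' s k) (at s)"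
    and bound: "\<And>s k. cmod (c' s k) \<le> (1 + \<bar>s\<bar>) * M k"
    and summ: "(\<lambda>k. weight k powr q * (M k)\<^sup>2) summable_on UNIV"
  shows "has_sobolev_derivative q (\<lambda>t. fourier_series (c t)) (fourier_series (c' t)) t"
proof -
  define R where "R h k = (c (t + h) k - c t k) / of_real h - c' t k" for h k
  define N where "N h = (\<Sum>\<^sub>\<infinity>k. weight k powr q * (cmod (R h k))\<^sup>2)" for h
  have M0: "M k \<ge> 0" for k
    using order_trans[OF norm_ge_zero bound[of 0 k]] by simp
  have R0: "((\<lambda>h. R h k) \<longlongrightarrow> 0) (at 0)" for k
    using has_vector_derivative_difference_quotient[OF deriv[of k t]]
    by (simp add: R_def LIM_zero_iff scaleR_conv_of_real divide_inverse mult.commute)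
  \<comment> \<open>For \<open>|h| \<le> 1\<close> the times involved satisfy
    \<open>1 + |s| \<le> 2 + |t|\<close>; the factor 2 adds the quotient and the derivative. At
    \<open>h = 0\<close> the quotient is 0 by convention, so the bound persists.\<close>
  have R_le: "cmod (R h k) \<le> 2 * (2 + \<bar>t\<bar>) * M k" if h: "\<bar>h\<bar> \<le> 1" for h k
  proof -
    have "cmod (c (t + h) k - c t k) \<le> (2 + \<bar>t\<bar>) * M k * norm (t + h - t)"
    proof (rule differentiable_bound[of "cball t 1"])
      show "((\<lambda>s. c s k) has_derivative (\<lambda>h. h *\<^sub>R c' s k)) (at s within cball t 1)" for s
        using deriv[of k s] unfolding has_vector_derivative_def by (rule has_derivative_at_withinI)
      show "onorm (\<lambda>h. h *\<^sub>R c' s k) \<le> (2 + \<bar>t\<bar>) * M k" if "s \<in> cball t 1" for s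
      proof (rule onorm_le)
        fix x :: real
        have "cmod (c' s k) \<le> (1 + \<bar>s\<bar>) * M k" by (rule bound)
        also have "\<dots> \<le> (2 + \<bar>t\<bar>) * M k"
          using that M0 by (intro mult_right_mono) (auto simp: dist_real_def)
        finally show "norm (x *\<^sub>R c' s k) \<le> (2 + \<bar>t\<bar>) * M k * norm x"
          by (simp add: mult_left_mono mult.commute[of _ "\<bar>x\<bar>"])
      qed
    qed (use h in \<open>auto simp: dist_real_def\<close>)
    hence "cmod ((c (t + h) k - c t k) / of_real h) \<le> (2 + \<bar>t\<bar>) * M k"
      using M0[of k] by (cases "h = 0") (auto simp: norm_divide pos_divide_le_eq)
    moreover have "cmod (c' t k) \<le> (2 + \<bar>t\<bar>) * M k"
      using M0[of k] by (intro order_trans[OF bound] mult_right_mono) auto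
    ultimately show ?thesis
      unfolding R_def by (intro order_trans[OF norm_triangle_ineq4]) linarith
  qed
  \<comment> \<open>The majorant is uniform in \<open>h\<close> on the unit ball, so the partial
    sums converge uniformly there and the limit in \<open>h\<close> may be taken inside the
    sum.\<close>
  have lim: "(N \<longlongrightarrow> 0) (at 0 within cball 0 1)"
  proof (rule swap_uniform_limit)
    show "\<forall>\<^sub>F X in finite_subsets_at_top UNIV.
        ((\<lambda>h. \<Sum>k\<in>X. weight k powr q * (cmod (R h k))\<^sup>2) \<longlongrightarrow> 0) (at 0 within cball 0 1)"
    proof (intro always_eventually allI tendsto_null_sum tendsto_mult_right_zero)
      fix k
      have "((\<lambda>h. (cmod (R h k))\<^sup>2) \<longlongrightarrow> 0) (at 0)"
        using tendsto_power[OF tendsto_norm[OF R0[of k]], of 2] by (simp only: norm_zero zero_power2)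
      thus "((\<lambda>h. (cmod (R h k))\<^sup>2) \<longlongrightarrow> 0) (at 0 within cball 0 1)"
        by (rule tendsto_within_subset[OF _ subset_UNIV])
    qed
    show "uniform_limit (cball 0 1) (\<lambda>X h. \<Sum>k\<in>X. weight k powr q * (cmod (R h k))\<^sup>2) N (finite_subsets_at_top UNIV)"
      unfolding N_def
    proof (rule Weierstrass_m_test_general)
      show "(\<lambda>k. (2 * (2 + \<bar>t\<bar>))\<^sup>2 * (weight k powr q * (M k)\<^sup>2)) summable_on UNIV"
        by (rule summable_on_cmult_right[OF summ])
      show "norm (weight k powr q * (cmod (R h k))\<^sup>2) \<le> (2 * (2 + \<bar>t\<bar>))\<^sup>2 * (weight k powr q * (M k)\<^sup>2)"
        if "h \<in> cball 0 1" for h k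
      proof -
        have "\<bar>h\<bar> \<le> 1" using that by simp
        from mult_left_mono[OF power_mono[OF R_le[OF this, of k] norm_ge_zero, of 2], of "weight k powr q"]
        show ?thesis by (simp add: power_mult_distrib abs_mult mult.left_commute mult.assoc)
      qed
    qed
  qed (auto simp: finite_subsets_at_top_neq_bot)
  have "at 0 within cball 0 1 = (at 0 :: real filter)"
    by (rule at_within_interior) (simp add: interior_cball)
  with lim have "(N \<longlongrightarrow> 0) (at 0)" by simp
  from tendsto_real_sqrt[OF this] have "((\<lambda>h. sqrt (N h)) \<longlongrightarrow> 0) (at 0)"
    by (simp only: real_sqrt_zero)
  hence "((\<lambda>h. sqrt (N h)) \<longlongrightarrow> 0) (at 0 within {h. t + h \<ge> 0})"
    by (rule tendsto_within_subset[OF _ subset_UNIV])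
  moreover have norm_eq: "sobolev_norm q (\<lambda>\<phi>. (fourier_series (c (t + h)) \<phi> - fourier_series (c t) \<phi>) / of_real h - fourier_series (c' t) \<phi>) = sqrt (N h)" for h
  proof -
    have "fourier_coeff (\<lambda>\<phi>. (u \<phi> - v \<phi>) / z - w \<phi>) k = (fourier_coeff u k - fourier_coeff v k) / z - fourier_coeff w k"
      for u v w :: "(real ^ 'n \<Rightarrow> complex) \<Rightarrow> complex" and z k
      by (simp add: fourier_coeff_def diff_divide_distrib mult.commute)
    thus ?thesis by (simp add: sobolev_norm_def N_def R_def fourier_coeff_fourier_series)
  qed
  ultimately show ?thesis
    unfolding has_sobolev_derivative_def norm_eq
    using fourier_series_in_sobolev[OF weighted_summable_mono[OF summ bound]] by blast
qed

text \<open>Induction on \<open>P\<close>: dropping the first member of the family \<open>c\<close>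
  leaves a family of the same kind for the derivative.\<close>

lemma C_sobolev_fourier_series:
  fixes c :: "nat \<Rightarrow> real \<Rightarrow> int ^ 'n \<Rightarrow> complex"
  assumes "\<And>j t k. j < P \<Longrightarrow> ((\<lambda>s. c j s k) has_vector_derivative c (Suc j) t k) (at t)"
    and "\<And>j t k. j \<le> P \<Longrightarrow> cmod (c j t k) \<le> (1 + \<bar>t\<bar>) * M j k"
    and "\<And>j. j \<le> P \<Longrightarrow> (\<lambda>k. weight k powr q * (M j k)\<^sup>2) summable_on UNIV"
  shows "(\<lambda>t. fourier_series (c 0 t)) \<in> C_sobolev P q"
  using assms
proof (induction P arbitrary: c M)
  case 0
  thus ?case using fourier_series_in_sobolev[OF weighted_summable_mono[OF 0(3) 0(2)]] by simp
next
  case (Suc P)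
  have "fourier_series (c 0 t) \<in> sobolev q" for t
    using fourier_series_in_sobolev[OF weighted_summable_mono[OF Suc.prems(3) Suc.prems(2)], of 0] by simp
  moreover have "(\<lambda>t. fourier_series (c (Suc 0) t)) \<in> C_sobolev P q"
    by (rule Suc.IH[of "\<lambda>j. c (Suc j)" "\<lambda>j. M (Suc j)"]) (simp_all add: Suc.prems)
  moreover have "has_sobolev_derivative q (\<lambda>t. fourier_series (c 0 t)) (fourier_series (c (Suc 0) t)) t" for t
    by (rule has_sobolev_derivative_fourier_series[where M = "M (Suc 0)"]) (simp_all add: Suc.prems)
  ultimately show ?case by (auto intro!: bexI[of _ "\<lambda>t. fourier_series (c (Suc 0) t)"])
qed

section \<open>The wave equation\<close>

text \<open>
  The \<open>j\<close>-th time derivative of a Fourier coefficient of the solution. The estimates hold for every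
  real \<open>\<omega>\<close>, including \<open>\<omega> = 0\<close> with \<open>x / 0 = 0\<close>, so neither the sign nor a lower bound of the
  multiplier is ever needed.
\<close>

definition oscillation :: "real \<Rightarrow> complex \<Rightarrow> complex \<Rightarrow> nat \<Rightarrow> real \<Rightarrow> complex" where
  "oscillation \<omega> a b j t =
     a * of_real (\<omega> ^ j * cos (\<omega> * t + real j * (pi / 2))) +
     b * of_real (\<omega> ^ j * sin (\<omega> * t + real j * (pi / 2)) / \<omega>)"

text \<open>Each derivative contributes a factor \<open>\<omega>\<close> and advances the phase by
  \<open>pi / 2\<close>. For \<open>\<omega> = 0\<close> the sine term and its derivative are both 0
  by the convention on division.\<close>

lemma oscillation_deriv:
  "((\<lambda>s. oscillation \<omega> a b j s) has_vector_derivative oscillation \<omega> a b (Suc j) t) (at t)"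
proof -
  let ?x = "\<omega> * t + real j * (pi / 2)"
  have *: "\<omega> * t + real (Suc j) * (pi / 2) = ?x + pi / 2" by (simp add: algebra_simps)
  have cs: "cos (?x + pi / 2) = - sin ?x" "sin (?x + pi / 2) = cos ?x" unfolding cos_add sin_add by simp_all
  have "((\<lambda>s. \<omega> ^ j * cos (\<omega> * s + real j * (pi / 2))) has_real_derivative \<omega> ^ Suc j * cos (?x + pi / 2)) (at t)"
    unfolding cs
    by (auto intro!: derivative_eq_intros)
  moreover have "((\<lambda>s. \<omega> ^ j * sin (\<omega> * s + real j * (pi / 2)) / \<omega>) has_real_derivative \<omega> ^ Suc j * sin (?x + pi / 2) / \<omega>) (at t)"
    unfolding cs
    by (cases "\<omega> = 0") (auto intro!: derivative_eq_intros)
  ultimately show ?thesis unfolding oscillation_def *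
    by (intro has_vector_derivative_add has_vector_derivative_mult_right has_vector_derivative_of_real)
qed

text \<open>The factor \<open>1 + |t|\<close> is forced by the sine term at \<open>j = 0\<close>,
  where \<open>|sin (\<omega> * t)| \<le> |\<omega> * t|\<close>. For \<open>j \<ge> 1\<close> the
  division cancels one power of \<open>\<omega>\<close>; truncated subtraction makes
  \<open>j - 1\<close> cover both cases.\<close>

lemma norm_oscillation_le:
  assumes \<omega>: "\<bar>\<omega>\<bar> \<le> \<Omega>" and \<Omega>: "\<Omega> \<ge> 1"
  shows "cmod (oscillation \<omega> a b j t) \<le> (1 + \<bar>t\<bar>) * (\<Omega> ^ j * cmod a + \<Omega> ^ (j - 1) * cmod b)"
proof -
  let ?x = "\<omega> * t + real j * (pi / 2)"
  have pw: "\<bar>\<omega>\<bar> ^ i \<le> \<Omega> ^ i" for i using \<omega> by (intro power_mono) auto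
  have "\<bar>\<omega> ^ j * cos ?x\<bar> \<le> \<Omega> ^ j * 1"
    unfolding abs_mult power_abs using \<Omega> by (intro mult_mono pw abs_cos_le_one) auto
  also have "\<dots> \<le> (1 + \<bar>t\<bar>) * \<Omega> ^ j" using \<Omega> by (simp add: algebra_simps)
  finally have c: "\<bar>\<omega> ^ j * cos ?x\<bar> \<le> (1 + \<bar>t\<bar>) * \<Omega> ^ j" .
  have s: "\<bar>\<omega> ^ j * sin ?x / \<omega>\<bar> \<le> (1 + \<bar>t\<bar>) * \<Omega> ^ (j - 1)"
  proof (cases "\<omega> = 0")
    case True thus ?thesis using \<Omega> by simp
  next
    case False
    show ?thesis
    proof (cases j)
      case 0
      have "\<bar>sin (\<omega> * t)\<bar> \<le> \<bar>\<omega>\<bar> * \<bar>t\<bar>" using abs_sin_x_le_abs_x[of "\<omega> * t"] by (simp add: abs_mult)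
      also have "\<dots> \<le> \<bar>\<omega>\<bar> * (1 + \<bar>t\<bar>)" by (intro mult_left_mono) auto
      finally show ?thesis using 0 False by (simp add: pos_divide_le_eq mult.commute)
    next
      case (Suc i)
      have "\<bar>\<omega> ^ j * sin ?x / \<omega>\<bar> = \<bar>\<omega>\<bar> ^ i * \<bar>sin ?x\<bar>"
        using False Suc by (simp add: abs_mult power_abs)
      also have "\<dots> \<le> \<Omega> ^ i * 1"
        using \<Omega> by (intro mult_mono pw abs_sin_le_one) auto
      also have "\<dots> \<le> (1 + \<bar>t\<bar>) * \<Omega> ^ i" using \<Omega> by (simp add: algebra_simps)
      finally show ?thesis using Suc by simp
    qed
  qed
  have "cmod (oscillation \<omega> a b j t) \<le> cmod a * \<bar>\<omega> ^ j * cos ?x\<bar> + cmod b * \<bar>\<omega> ^ j * sin ?x / \<omega>\<bar>"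
    unfolding oscillation_def by (rule order_trans[OF norm_triangle_ineq]) (simp only: norm_mult norm_of_real order_refl)
  also have "\<dots> \<le> cmod a * ((1 + \<bar>t\<bar>) * \<Omega> ^ j) + cmod b * ((1 + \<bar>t\<bar>) * \<Omega> ^ (j - 1))"
    by (intro add_mono mult_left_mono c s) auto
  finally show ?thesis by (simp add: algebra_simps)
qed

section \<open>Balancing derivatives against the regularity of the data\<close>

text \<open>One power of the frequency majorant is \<open>weight k powr (\<kappa> / 2)\<close> up to
  a constant; squared, \<open>i\<close> of them cost \<open>i * \<kappa>\<close> in the Sobolev
  exponent.\<close>

lemma weighted_summable_power:
  fixes u :: "(real ^ 'n \<Rightarrow> complex) \<Rightarrow> complex"
  assumes u: "u \<in> sobolev r" and C: "C \<ge> 0" and q: "q + real i * \<kappa> \<le> r"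
  shows "(\<lambda>k. weight k powr q * ((sqrt C * weight k powr (\<kappa> / 2)) ^ i * cmod (fourier_coeff u k))\<^sup>2) summable_on UNIV"
proof (rule summable_on_comparison_test)
  show "(\<lambda>k. C ^ i * (weight k powr r * (cmod (fourier_coeff u k))\<^sup>2)) summable_on UNIV"
    using u by (intro summable_on_cmult_right) (simp add: sobolev_def)
  fix k :: "int ^ 'n"
  have w: "weight k > 0" using weight_ge_one[of k] by linarith
  have "((sqrt C * weight k powr (\<kappa> / 2)) ^ i)\<^sup>2 = ((sqrt C)\<^sup>2 * (weight k powr (\<kappa> / 2))\<^sup>2) ^ i"
    by (simp add: power_mult_distrib mult.commute flip: power_mult)
  also have "(weight k powr (\<kappa> / 2))\<^sup>2 = weight k powr \<kappa>"
    by (simp add: power2_eq_square flip: powr_add)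
  also have "((sqrt C)\<^sup>2 * weight k powr \<kappa>) ^ i = C ^ i * weight k powr (real i * \<kappa>)"
    using C w by (simp add: power_mult_distrib powr_power mult.commute)
  finally have "weight k powr q * ((sqrt C * weight k powr (\<kappa> / 2)) ^ i * cmod (fourier_coeff u k))\<^sup>2
      = C ^ i * (weight k powr (q + real i * \<kappa>) * (cmod (fourier_coeff u k))\<^sup>2)"
    by (simp add: power_mult_distrib powr_add mult_ac)
  also have "\<dots> \<le> C ^ i * (weight k powr r * (cmod (fourier_coeff u k))\<^sup>2)"
    using C q by (intro mult_left_mono mult_right_mono powr_mono weight_ge_one) auto
  finally show "weight k powr q * ((sqrt C * weight k powr (\<kappa> / 2)) ^ i * cmod (fourier_coeff u k))\<^sup>2
      \<le> C ^ i * (weight k powr r * (cmod (fourier_coeff u k))\<^sup>2)" .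
qed auto

text \<open>Derivative \<open>j\<close> puts \<open>j\<close> frequency factors on \<open>f\<close>
  and \<open>j - 1\<close> on \<open>g\<close>; as \<open>\<kappa> \<ge> 0\<close>, the two exponent
  conditions at the top order \<open>P\<close> imply those for all lower orders.\<close>

lemma wave_solution_in_C_sobolev:
  fixes \<delta> \<beta> \<kappa> s1 s2 q :: real and f g :: "(real ^ 'n \<Rightarrow> complex) \<Rightarrow> complex"
  assumes \<delta>: "\<delta> > 0" and \<beta>: "\<beta> < real CARD('n) + 4"
    and \<kappa>: "\<kappa> \<ge> 0" "\<kappa> \<ge> (\<beta> - real CARD('n)) / 2" "\<beta> = real CARD('n) \<Longrightarrow> \<kappa> > 0"
    and f: "f \<in> sobolev s1" and g: "g \<in> sobolev s2"
    and q1: "q + real P * \<kappa> \<le> s1" and q2: "q + real (P - 1) * \<kappa> \<le> s2"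
  shows "wave_solution \<delta> \<beta> f g \<in> C_sobolev P q"
proof -
  obtain C where C: "C \<ge> 1" and
    m: "\<And>\<nu>::real ^ 'n. norm \<nu> \<ge> 1 \<Longrightarrow> \<bar>multiplier \<delta> \<beta> \<nu>\<bar> \<le> C * (1 + (norm \<nu>)\<^sup>2) powr \<kappa>"
    using multiplier_bound[where ?'n = 'n, OF \<delta> \<beta> \<kappa>] by metis
  define \<omega> where "\<omega> k = sqrt (- multiplier \<delta> \<beta> (real_vec (k :: int ^ 'n)))" for k
  define \<Omega> where "\<Omega> k = sqrt C * weight k powr (\<kappa> / 2)" for k :: "int ^ 'n"
  have "1 * 1 \<le> \<Omega> k" for k
    unfolding \<Omega>_def using C \<kappa> by (intro mult_mono ge_one_powr_ge_zero weight_ge_one) auto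
  hence \<Omega>1: "\<Omega> k \<ge> 1" for k by simp
  have \<omega>\<Omega>: "\<bar>\<omega> k\<bar> \<le> \<Omega> k" if "k \<noteq> 0" for k
  proof -
    \<comment> \<open>\<open>sqrt\<close> is an odd function on the reals, so this holds whatever
      the sign of the multiplier.\<close>
    have "\<bar>\<omega> k\<bar> = sqrt \<bar>multiplier \<delta> \<beta> (real_vec k)\<bar>"
      by (simp add: \<omega>_def real_sqrt_abs2 real_sqrt_minus flip: real_sqrt_abs')
    also have "\<dots> \<le> sqrt (C * weight k powr \<kappa>)"
      using m[OF norm_real_vec_ge_one[OF that]] by simp
    also have "\<dots> = \<Omega> k"
      using weight_ge_one[of k] by (simp add: \<Omega>_def real_sqrt_mult powr_half_sqrt[symmetric] powr_powr)
    finally show ?thesis .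
  qed
  define a where "a = fourier_coeff f"
  define b where "b = fourier_coeff g"
  \<comment> \<open>The zero mode is linear in time: its first derivative is \<open>b 0\<close> and
    all later ones vanish.\<close>
  define c where "c j t k = (if k = 0 then (if j = 0 then a 0 + b 0 * of_real t else if j = 1 then b 0 else 0)
    else oscillation (\<omega> k) (a k) (b k) j t)" for j t and k :: "int ^ 'n"
  have memb: "(\<lambda>t. fourier_series (c 0 t)) \<in> C_sobolev P q"
  proof (rule C_sobolev_fourier_series[where M = "\<lambda>j k. \<Omega> k ^ j * cmod (a k) + \<Omega> k ^ (j - 1) * cmod (b k)"])
    show "((\<lambda>s. c j s k) has_vector_derivative c (Suc j) t k) (at t)" for j t k
    proof (cases "k = 0")
      case True
      have "((\<lambda>s. a 0 + b 0 * of_real s) has_vector_derivative b 0) (at t)"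
        by (auto intro!: derivative_eq_intros)
      thus ?thesis using True by (simp add: c_def)
    qed (simp add: c_def oscillation_deriv)
    show "cmod (c j t k) \<le> (1 + \<bar>t\<bar>) * (\<Omega> k ^ j * cmod (a k) + \<Omega> k ^ (j - 1) * cmod (b k))" for j t k
    proof (cases "k = 0")
      case False
      thus ?thesis using norm_oscillation_le[OF \<omega>\<Omega> \<Omega>1] by (simp add: c_def)
    next
      case True
      have "cmod (c j t k) \<le> (1 + \<bar>t\<bar>) * (cmod (a 0) + cmod (b 0))"
      proof -
        have "cmod (a 0 + b 0 * of_real t) \<le> cmod (a 0) + cmod (b 0) * \<bar>t\<bar>"
          by (rule order_trans[OF norm_triangle_ineq]) (simp add: norm_mult)
        hence "cmod (c j t k) \<le> max (cmod (a 0) + cmod (b 0) * \<bar>t\<bar>) (cmod (b 0))"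
          using True by (auto simp: c_def le_max_iff_disj)
        also have "\<dots> \<le> (1 + \<bar>t\<bar>) * (cmod (a 0) + cmod (b 0))"
          by (simp add: algebra_simps)
        finally show ?thesis .
      qed
      also have "\<dots> \<le> (1 + \<bar>t\<bar>) * (\<Omega> k ^ j * cmod (a k) + \<Omega> k ^ (j - 1) * cmod (b k))"
        using mult_right_mono[OF one_le_power[OF \<Omega>1[of 0], of j], of "cmod (a 0)"]
          mult_right_mono[OF one_le_power[OF \<Omega>1[of 0], of "j - 1"], of "cmod (b 0)"]
        unfolding True by (intro mult_left_mono) auto
      finally show ?thesis .
    qed
    show "(\<lambda>k. weight k powr q * (\<Omega> k ^ j * cmod (a k) + \<Omega> k ^ (j - 1) * cmod (b k))\<^sup>2) summable_on UNIV"
      if j: "j \<le> P" for j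
    proof (rule summable_on_comparison_test)
      have "real j * \<kappa> \<le> real P * \<kappa>" "real (j - 1) * \<kappa> \<le> real (P - 1) * \<kappa>"
        using \<kappa> j by (auto intro!: mult_right_mono)
      hence "q + real j * \<kappa> \<le> s1" "q + real (j - 1) * \<kappa> \<le> s2" using q1 q2 by linarith+
      with C show "(\<lambda>k. 2 * (weight k powr q * (\<Omega> k ^ j * cmod (a k))\<^sup>2)
          + 2 * (weight k powr q * (\<Omega> k ^ (j - 1) * cmod (b k))\<^sup>2)) summable_on UNIV"
        unfolding \<Omega>_def a_def b_def
        by (intro summable_on_add summable_on_cmult_right weighted_summable_power[OF f] weighted_summable_power[OF g]) auto
      fix k
      \<comment> \<open>Separates the contributions of \<open>f\<close> and \<open>g\<close> under
        the square.\<close>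
      have "(x + y)\<^sup>2 \<le> 2 * x\<^sup>2 + 2 * y\<^sup>2" for x y :: real
        using zero_le_power2[of "x - y"] by (simp add: power2_eq_square algebra_simps)
      from mult_left_mono[OF this, of "weight k powr q"]
      show "weight k powr q * (\<Omega> k ^ j * cmod (a k) + \<Omega> k ^ (j - 1) * cmod (b k))\<^sup>2
        \<le> 2 * (weight k powr q * (\<Omega> k ^ j * cmod (a k))\<^sup>2) + 2 * (weight k powr q * (\<Omega> k ^ (j - 1) * cmod (b k))\<^sup>2)"
        by (simp add: distrib_left mult.left_commute)
    qed auto
  qed
  have coeff: "wave_coeff \<delta> \<beta> f g t = c 0 t" for t
  proof (rule ext)
    show "wave_coeff \<delta> \<beta> f g t k = c 0 t k" for k
      unfolding wave_coeff_def Let_def \<omega>_def[symmetric] a_def[symmetric] b_def[symmetric] c_def oscillation_def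
      by simp
  qed
  have "wave_solution \<delta> \<beta> f g = (\<lambda>t. fourier_series (c 0 t))"
    by (rule ext) (simp only: wave_solution_def coeff)
  with memb show ?thesis by (simp only:)
qed

theorem theorem6:
  fixes \<delta> \<beta> s1 s2 \<theta> s :: real
    and f g :: "(real ^ 'n \<Rightarrow> complex) \<Rightarrow> complex"
    and U :: "real \<Rightarrow> (real ^ 'n \<Rightarrow> complex) \<Rightarrow> complex"
  assumes "\<delta> > 0"
    and "\<beta> < real CARD('n) + 4"
    and "f \<in> sobolev s1"
    and "g \<in> sobolev s2"
    and "\<theta> = max 0 ((\<beta> - real CARD('n)) / 2)"
    and "s = min s1 (s2 + \<theta>)"
    and "U = wave_solution \<delta> \<beta> f g"
  shows "(\<beta> < real CARD('n) \<longrightarrow> (\<forall>q::real. q \<le> s \<longrightarrow> U \<in> Cinf_sobolev q)) \<and>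
         (\<beta> = real CARD('n) \<longrightarrow> (\<forall>q::real. q < s \<longrightarrow> U \<in> Cinf_sobolev q)) \<and>
         (\<beta> > real CARD('n) \<longrightarrow>
            (\<forall>(q::real) (p::nat). p > 0 \<longrightarrow>
               q - s1 + real (p + 1) * ((\<beta> - real CARD('n)) / 2) \<le> 0 \<longrightarrow>
               q - s2 + real p * ((\<beta> - real CARD('n)) / 2) \<le> 0 \<longrightarrow>
               U \<in> C_sobolev (p + 1) q))"
proof (intro conjI impI allI)
  note wave = wave_solution_in_C_sobolev[OF assms(1,2) _ _ _ assms(3,4), folded assms(7)]
  fix q :: real
  \<comment> \<open>With \<open>\<kappa> = 0\<close> no derivative loses regularity, and
    \<open>\<theta> = 0\<close> turns \<open>q \<le> s\<close> into the condition for every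
    order.\<close>
  show "U \<in> Cinf_sobolev q" if "\<beta> < real CARD('n)" "q \<le> s"
    unfolding Cinf_sobolev_def using that assms(5,6) by (auto intro!: wave[where \<kappa> = 0])
  show "U \<in> Cinf_sobolev q" if \<beta>: "\<beta> = real CARD('n)" and q: "q < s"
    unfolding Cinf_sobolev_def
  proof
    fix P :: nat
    \<comment> \<open>The gap between \<open>q\<close> and \<open>s\<close> is divided among the
      \<open>P\<close> derivatives; \<open>P + 1\<close> keeps the denominator positive at
      \<open>P = 0\<close>.\<close>
    define \<kappa> where "\<kappa> = (s - q) / (real P + 1)"
    have \<kappa>: "\<kappa> > 0" using q by (simp add: \<kappa>_def)
    have "q + (real P + 1) * \<kappa> = s" by (simp add: \<kappa>_def)
    moreover have "real (P - 1) * \<kappa> \<le> (real P + 1) * \<kappa>" using \<kappa> by (intro mult_right_mono) auto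
    moreover have "s \<le> s1" "s \<le> s2" using assms(5,6) \<beta> by auto
    ultimately show "U \<in> C_sobolev P q"
      using \<kappa> \<beta> by (intro wave[where \<kappa> = \<kappa>]) (auto simp: algebra_simps)
  qed
  \<comment> \<open>For \<open>P = p + 1\<close> the exponents \<open>P * \<kappa>\<close> and
    \<open>(P - 1) * \<kappa>\<close> are exactly those in the two assumed inequalities.\<close>
  show "U \<in> C_sobolev (p + 1) q"
    if "\<beta> > real CARD('n)" "q - s1 + real (p + 1) * ((\<beta> - real CARD('n)) / 2) \<le> 0"
      "q - s2 + real p * ((\<beta> - real CARD('n)) / 2) \<le> 0" for p
    using that by (intro wave[where \<kappa> = "(\<beta> - real CARD('n)) / 2"]) auto
qed

end
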